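(* Let $\mathbb{K}\in\{\mathbb{R},\mathbb{C}\}$, and let $\kappa$ be any cardinal with $1\le\kappa\le\mathfrak{c}$, where $\mathfrak{c}$ is the cardinal of $\mathbb{R}$. Let $\mathfrak{M}$ be the maximal ideal space of the Banach algebra $L^{\infty}(\mathbb{T})$, and let $\mathcal{N}\cup\{\infty\}$ be the one-point compactification of a countably infinite discrete space $\mathcal{N}$. Then the Banach space $C\left(\mathfrak{M}+\mathbb{T}^{\kappa}+\mathcal{N}\cup\{\infty\}\right)$ of $\mathbb{K}$-valued continuous functions on the topological sum of $\mathfrak{M}$, $\mathbb{T}^{\kappa}$ and $\mathcal{N}\cup\{\infty\}$ admits an isometric shift.
   Context: $\mathbb{T}$ is the unit circle in $\mathbb{C}$ with Lebesgue measure, $\mathbb{T}^{\kappa}$ is the product of $\kappa$ copies of $\mathbb{T}$ with the product topology, and $L^{\infty}(\mathbb{T})$ is the algebra of essentially bounded measurable complex-valued functions on $\mathbb{T}$ (complex-valued whichever $\mathbb{K}$ is used); $\mathfrak{M}$ carries the Gelfand topology. "$+$" denotes topological sum (disjoint union). For a compact Hausdorff space $X$, $C(X)$ is the Banach space of all $\mathbb{K}$-valued continuous functions on $X$ with the supremum norm. A linear operator $T:E\to E$ on a Banach space $E$ is an isometric shift if (1) $T$ is an isometry (not necessarily surjective), (2) $T(E)$ has codimension $1$ in $E$, and (3) $\bigcap_{n=1}^{\infty}T^n(E)=\{0\}$. "$C(X)$ admits an isometric shift" means that such a $T:C(X)\to C(X)$ exists. *)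

theory Defs
  imports "HOL-Analysis.Analysis"
begin

text \<open>
  Arc length on the Borel subsets of the unit circle. The total mass is \<open>2 * pi\<close>; only the null
  sets matter for \<open>L\<^sup>\<infinity>\<close>. Since every Lebesgue measurable function agrees almost everywhere with a
  Borel one, Borel representatives give the same algebra of classes.
\<close>
definition circle_measure :: "complex measure" where
  "circle_measure =
     distr (restrict_space lborel {0..<2 * pi}) (restrict_space borel (sphere 0 1)) cis"

lemma space_circle_measure [simp]: "space circle_measure = sphere 0 1"
  by (simp add: circle_measure_def space_restrict_space)

lemma sets_circle_measure: "sets circle_measure = sets (restrict_space borel (sphere 0 1))"
  by (simp add: circle_measure_def)

lemma measurable_cis_circle:
  "cis \<in> restrict_space lborel {0..<2 * pi} \<rightarrow>\<^sub>M restrict_space borel (sphere 0 1)"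
proof (rule measurable_restrict_space2)
  have "cis \<in> borel_measurable borel"
    by (intro borel_measurable_continuous_onI continuous_intros)
  then show "cis \<in> restrict_space lborel {0..<2 * pi} \<rightarrow>\<^sub>M borel"
    by (intro measurable_restrict_space1) simp
qed auto

lemma emeasure_circle_measure_total: "emeasure circle_measure (sphere 0 1) = ennreal (2 * pi)"
proof -
  have "sphere 0 1 \<in> sets (restrict_space borel (sphere (0::complex) 1))"
    using sets.top[of "restrict_space borel (sphere (0::complex) 1)"]
    by (simp add: space_restrict_space)
  then have "emeasure circle_measure (sphere 0 1) =
      emeasure (restrict_space lborel {0..<2 * pi})
        (cis -` sphere 0 1 \<inter> space (restrict_space lborel {0..<2 * pi}))"
    unfolding circle_measure_def by (intro emeasure_distr measurable_cis_circle)
  also have "cis -` sphere 0 1 \<inter> space (restrict_space lborel {0..<2 * pi}) = {0..<2 * pi}"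
    by (auto simp: space_restrict_space)
  also have "emeasure (restrict_space lborel {0..<2 * pi}) {0..<2 * pi} = ennreal (2 * pi)"
    by (subst emeasure_restrict_space) auto
  finally show ?thesis .
qed

definition ess_bounded :: "(complex \<Rightarrow> complex) \<Rightarrow> bool" where
  "ess_bounded f \<longleftrightarrow>
     f \<in> borel_measurable circle_measure \<and> (\<exists>B. AE z in circle_measure. norm (f z) \<le> B)"

lemma ess_bounded_const: "ess_bounded (\<lambda>_. c)"
  by (auto simp: ess_bounded_def)

lemma ess_bounded_add:
  assumes "ess_bounded f" "ess_bounded g"
  shows "ess_bounded (\<lambda>z. f z + g z)"
proof -
  from assms obtain A B where
    "AE z in circle_measure. norm (f z) \<le> A" "AE z in circle_measure. norm (g z) \<le> B"
    by (auto simp: ess_bounded_def)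
  then have "AE z in circle_measure. norm (f z + g z) \<le> A + B"
    by eventually_elim (rule norm_triangle_mono)
  with assms show ?thesis
    by (auto simp: ess_bounded_def)
qed

lemma ess_bounded_mult:
  assumes "ess_bounded f" "ess_bounded g"
  shows "ess_bounded (\<lambda>z. f z * g z)"
proof -
  from assms obtain A B where
    "AE z in circle_measure. norm (f z) \<le> A" "AE z in circle_measure. norm (g z) \<le> B"
    by (auto simp: ess_bounded_def)
  then have "AE z in circle_measure. norm (f z * g z) \<le> A * B"
    by eventually_elim (metis norm_mult mult_mono' norm_ge_zero)
  with assms show ?thesis
    by (auto simp: ess_bounded_def)
qed

definition linf_rel :: "(complex \<Rightarrow> complex) \<Rightarrow> (complex \<Rightarrow> complex) \<Rightarrow> bool" where
  "linf_rel f g \<longleftrightarrow> ess_bounded f \<and> ess_bounded g \<and> (AE z in circle_measure. f z = g z)"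

lemma part_equivp_linf_rel: "part_equivp linf_rel"
proof (rule part_equivpI)
  show "\<exists>f. linf_rel f f"
    by (auto simp: linf_rel_def intro!: exI[of _ "\<lambda>_. 0"] ess_bounded_const)
  show "symp linf_rel"
    by (rule sympI) (auto simp: linf_rel_def eq_commute)
  show "transp linf_rel"
  proof (rule transpI)
    fix f g h assume "linf_rel f g" "linf_rel g h"
    then show "linf_rel f h"
      unfolding linf_rel_def by (auto elim: eventually_elim2)
  qed
qed

quotient_type linf = "complex \<Rightarrow> complex" / partial: linf_rel
  by (rule part_equivp_linf_rel)

lemma linf_rel_add:
  "linf_rel f f' \<Longrightarrow> linf_rel g g' \<Longrightarrow> linf_rel (\<lambda>z. f z + g z) (\<lambda>z. f' z + g' z)"
  by (auto simp: linf_rel_def intro: ess_bounded_add elim: eventually_elim2)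

lemma linf_rel_mult:
  "linf_rel f f' \<Longrightarrow> linf_rel g g' \<Longrightarrow> linf_rel (\<lambda>z. f z * g z) (\<lambda>z. f' z * g' z)"
  by (auto simp: linf_rel_def intro: ess_bounded_mult elim: eventually_elim2)

lemma linf_rel_const: "linf_rel (\<lambda>_. c) (\<lambda>_. c)"
  by (simp add: linf_rel_def ess_bounded_const)

lemma linf_rel_cmult: "linf_rel f f' \<Longrightarrow> linf_rel (\<lambda>z. c * f z) (\<lambda>z. c * f' z)"
  by (rule linf_rel_mult[OF linf_rel_const])

lemma linf_rel_uminus: "linf_rel f f' \<Longrightarrow> linf_rel (\<lambda>z. - f z) (\<lambda>z. - f' z)"
  using linf_rel_cmult[of f f' "-1"] by simp

lemma linf_rel_diff:
  "linf_rel f f' \<Longrightarrow> linf_rel g g' \<Longrightarrow> linf_rel (\<lambda>z. f z - g z) (\<lambda>z. f' z - g' z)"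
  using linf_rel_add[OF _ linf_rel_uminus, of f f' g g'] by simp

instantiation linf :: comm_ring_1
begin

lift_definition zero_linf :: linf is "\<lambda>_. 0" by (rule linf_rel_const)
lift_definition one_linf :: linf is "\<lambda>_. 1" by (rule linf_rel_const)
lift_definition plus_linf :: "linf \<Rightarrow> linf \<Rightarrow> linf" is "\<lambda>f g z. f z + g z" by (rule linf_rel_add)
lift_definition minus_linf :: "linf \<Rightarrow> linf \<Rightarrow> linf" is "\<lambda>f g z. f z - g z" by (rule linf_rel_diff)
lift_definition uminus_linf :: "linf \<Rightarrow> linf" is "\<lambda>f z. - f z" by (rule linf_rel_uminus)
lift_definition times_linf :: "linf \<Rightarrow> linf \<Rightarrow> linf" is "\<lambda>f g z. f z * g z" by (rule linf_rel_mult)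

instance
proof
  have "\<not> (AE z in circle_measure. (0::complex) = 1)"
  proof
    assume "AE z in circle_measure. (0::complex) = 1"
    then have "emeasure circle_measure (space circle_measure) = 0"
      by (subst (asm) AE_iff_measurable[OF sets.top]) (simp_all add: sphere_def)
    then show False
      using emeasure_circle_measure_total by simp
  qed
  then show "(0::linf) \<noteq> 1"
    by (transfer) (simp add: linf_rel_def)
qed (transfer; simp add: algebra_simps linf_rel_add linf_rel_diff linf_rel_mult linf_rel_const)+

end

lift_definition linf_scale :: "complex \<Rightarrow> linf \<Rightarrow> linf" is "\<lambda>c f z. c * f z"
  by (rule linf_rel_cmult)

text \<open>
  The maximal ideal space is the set of nonzero complex homomorphisms, and the Gelfand topology is
  the topology of pointwise convergence. Boundedness is not required: it is automatic for complex
  homomorphisms of a Banach algebra.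
\<close>
definition linf_characters :: "(linf \<Rightarrow> complex) set" where
  "linf_characters =
     {\<phi>. (\<forall>f g. \<phi> (f + g) = \<phi> f + \<phi> g) \<and> (\<forall>c f. \<phi> (linf_scale c f) = c * \<phi> f) \<and>
          (\<forall>f g. \<phi> (f * g) = \<phi> f * \<phi> g) \<and> \<phi> \<noteq> (\<lambda>_. 0)}"

definition linf_max_ideal_space :: "(linf \<Rightarrow> complex) topology" where
  "linf_max_ideal_space =
     subtopology (product_topology (\<lambda>_. euclidean) UNIV) linf_characters"

definition torus :: "'i set \<Rightarrow> ('i \<Rightarrow> complex) topology" where
  "torus I = product_topology (\<lambda>_. top_of_set (sphere 0 1)) I"

text \<open>
  The library's \<^const>\<open>sum_topology\<close> only sums families of spaces over one common type.
\<close>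
definition disjoint_sum :: "'a topology \<Rightarrow> 'b topology \<Rightarrow> ('a + 'b) topology" where
  "disjoint_sum X Y = topology (\<lambda>U. openin X (Inl -` U) \<and> openin Y (Inr -` U))"

lemma openin_disjoint_sum:
  "openin (disjoint_sum X Y) U \<longleftrightarrow> openin X (Inl -` U) \<and> openin Y (Inr -` U)"
proof -
  have "istopology (\<lambda>U. openin X (Inl -` U) \<and> openin Y (Inr -` U))"
    unfolding istopology_def vimage_Int vimage_Union by (blast intro: openin_Int openin_Union)
  then show ?thesis
    by (simp add: disjoint_sum_def)
qed

lemma topspace_disjoint_sum:
  "topspace (disjoint_sum X Y) = Inl ` topspace X \<union> Inr ` topspace Y"
proof (rule antisym)
  let ?W = "Inl ` topspace X \<union> Inr ` topspace Y"
  have "Inl -` ?W = topspace X" "Inr -` ?W = topspace Y" by auto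
  then have "openin (disjoint_sum X Y) ?W"
    by (simp add: openin_disjoint_sum)
  then show "?W \<subseteq> topspace (disjoint_sum X Y)"
    by (rule openin_subset)
  have "openin (disjoint_sum X Y) (topspace (disjoint_sum X Y))" by simp
  then have *: "Inl -` topspace (disjoint_sum X Y) \<subseteq> topspace X"
      "Inr -` topspace (disjoint_sum X Y) \<subseteq> topspace Y"
    unfolding openin_disjoint_sum by (auto dest: openin_subset)
  show "topspace (disjoint_sum X Y) \<subseteq> ?W"
  proof
    fix z assume "z \<in> topspace (disjoint_sum X Y)"
    with * show "z \<in> ?W" by (cases z) auto
  qed
qed

text \<open>
  Functions are normalised to be \<open>0\<close> off the space, so that \<open>C X\<close> is a subspace of the vector space
  of all functions on the underlying type.
\<close>
definition cont_funs :: "'a topology \<Rightarrow> ('a \<Rightarrow> 'k::real_normed_field) set" where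
  "cont_funs X = {f. continuous_map X euclidean f \<and> (\<forall>x. x \<notin> topspace X \<longrightarrow> f x = 0)}"

text \<open>Meant for nonempty compact spaces.\<close>
definition sup_norm :: "'a topology \<Rightarrow> ('a \<Rightarrow> 'k::real_normed_field) \<Rightarrow> real" where
  "sup_norm X f = (SUP x\<in>topspace X. norm (f x))"

text \<open>
  For a linear subspace \<open>M\<close> of a space \<open>E\<close> of scalar functions: the classes modulo \<open>M\<close> of some
  \<open>b 0, \<dots>, b (n - 1)\<close> in \<open>E\<close> form a basis of the quotient \<open>E / M\<close>.
\<close>
definition has_codimension ::
    "('a \<Rightarrow> 'k::real_normed_field) set \<Rightarrow> ('a \<Rightarrow> 'k) set \<Rightarrow> nat \<Rightarrow> bool" where
  "has_codimension E M n \<longleftrightarrow>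
     (\<exists>b. (\<forall>i<n. b i \<in> E) \<and>
          (\<forall>f\<in>E. \<exists>!c. c \<in> extensional {..<n} \<and> (\<lambda>x. f x - (\<Sum>i<n. c i * b i x)) \<in> M))"

definition isometric_shift ::
    "('a \<Rightarrow> 'k::real_normed_field) set \<Rightarrow> (('a \<Rightarrow> 'k) \<Rightarrow> real) \<Rightarrow> (('a \<Rightarrow> 'k) \<Rightarrow> ('a \<Rightarrow> 'k)) \<Rightarrow> bool" where
  "isometric_shift E N T \<longleftrightarrow>
     (\<forall>f\<in>E. T f \<in> E) \<and>
     (\<forall>f\<in>E. \<forall>g\<in>E. T (\<lambda>x. f x + g x) = (\<lambda>x. T f x + T g x)) \<and>
     (\<forall>c. \<forall>f\<in>E. T (\<lambda>x. c * f x) = (\<lambda>x. c * T f x)) \<and>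
     (\<forall>f\<in>E. N (T f) = N f) \<and>
     has_codimension E (T ` E) 1 \<and>
     (\<Inter>n\<in>{1..}. (T ^^ n) ` E) = {\<lambda>_. 0}"

definition admits_isometric_shift :: "('a \<Rightarrow> 'k::real_normed_field) set \<Rightarrow> (('a \<Rightarrow> 'k) \<Rightarrow> real) \<Rightarrow> bool" where
  "admits_isometric_shift E N \<longleftrightarrow> (\<exists>T. isometric_shift E N T)"

end

theory Submission
  imports Defs
begin

text \<open>
  Write the space as \<open>Z + (N \<union> {\<infinity>})\<close> with \<open>Z = M + T\<^sup>\<kappa>\<close>, enumerate \<open>N\<close> as \<open>p\<^sub>0, p\<^sub>1, \<dots>\<close> and let \<open>U\<close> be an
  invertible weighted composition operator on \<open>C(Z)\<close> and \<open>\<mu>\<close> a functional of norm at most \<open>1\<close>. Put \<open>T f = U f\<close> on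
  \<open>Z\<close>, \<open>T f (\<infinity>) = f (\<infinity>)\<close>, \<open>T f (p\<^sub>k\<^sub>+\<^sub>1) = f (p\<^sub>k)\<close> and \<open>T f (p\<^sub>0) = \<mu> f\<close>. A function \<open>f\<close> in the range of every
  \<open>T\<^sup>n\<close> satisfies \<open>f (p\<^sub>n) = \<mu> (U\<^sup>-\<^sup>n\<^sup>-\<^sup>1 f)\<close>, which has to converge to \<open>f (\<infinity>)\<close>; so \<open>T\<close> is a shift as soon as no
  nonzero orbit of \<open>U\<^sup>-\<^sup>1\<close> converges under \<open>\<mu>\<close>.

  On the torus, \<open>U\<^sup>-\<^sup>1\<close> is a rotation composed with multiplication by \<open>-1\<close>. On \<open>M\<close> it is a translation by \<open>\<theta>\<close> of
  functions on the circle extended to the line so that they change sign after a full turn; this removes the constant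
  eigenfunctions, and in the real case all eigenvalues. The functional is half the mean over the circle plus half the
  value at the unit of the torus. Writing \<open>\<Phi> s\<close> for the integral of the translate by \<open>s\<close> of the element of
  \<open>L\<^sup>\<infinity>\<close> given by \<open>f\<close>, one has \<open>\<Phi> (s + 2\<pi>) = - \<Phi> s\<close>. If all angles are independent over the rationals together
  with \<open>1\<close>, Kronecker's theorem turns convergence into \<open>\<plusminus> \<Phi> s \<plusminus> f x = const\<close> for all choices of signs, hence
  \<open>\<Phi> = 0\<close> and \<open>f = 0\<close> on the torus. As \<open>\<Phi> s\<close> is a constant minus twice the integral over \<open>[0, s]\<close>, the function
  \<open>f\<close> vanishes on \<open>M\<close> as well. A family of continuum many independent angles is given by sums of reciprocal factorials over
  almost disjoint sets of integers.
\<close>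

section \<open>Rationally independent angles\<close>

text \<open>Fourier's argument for the irrationality of the number e. Multiplied by
  \<open>fact n\<close>, the tail after \<open>n\<close> is an integer, and for \<open>n > D\<close>
  it is smaller than 1 in modulus, so it is 0.\<close>

lemma factorial_series_int_coeffs_eventually_zero:
  fixes d :: "nat \<Rightarrow> int" and D c :: int
  assumes bd: "\<And>n. \<bar>d n\<bar> \<le> D" and sums: "(\<lambda>n. of_int (d n) / fact n :: real) sums of_int c"
  shows "\<forall>\<^sub>F n in sequentially. d n = 0"
proof -
  define e where "e n = (of_int (d n) / fact n :: real)" for n
  define R where "R n = (\<Sum>k. e (k + Suc n))" for n
  have summ: "summable e" using sums unfolding e_def by (rule sums_summable)
  then have summ_tail: "summable (\<lambda>k. e (k + m))" for m by (rule summable_ignore_initial_segment)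
  have R_zero: "R n = 0" if n: "n > nat D" for n
  proof -
    \<comment> \<open>Beyond \<open>fact n\<close> the larger factorial has \<open>k + 1\<close>
      factors, each at least \<open>n + 1\<close>. This gives a geometric majorant of ratio
      \<open>q = 1 / (n + 1)\<close>, with total at most \<open>D / n\<close>.\<close>
    have fact_le: "(fact n * (real n + 1) ^ Suc k) \<le> fact (k + Suc n)" for k
    proof (induction k)
      case (Suc k)
      have "fact n * (real n + 1) ^ Suc (Suc k) = (real n + 1) * (fact n * (real n + 1) ^ Suc k)" by simp
      also have "\<dots> \<le> (real (k + Suc n) + 1) * fact (k + Suc n)"
        using Suc by (intro mult_mono) auto
      finally show ?case by (simp add: algebra_simps)
    qed simp
    have Dn: "0 \<le> D" "real_of_int D < n" using bd[of 0] n by linarith+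
    define q where "q = 1 / (real n + 1)"
    have q: "0 < q" "q < 1" using n by (auto simp: q_def)
    have "\<bar>fact n * e (k + Suc n)\<bar> \<le> D * q * q ^ k" for k
    proof -
      have "\<bar>fact n * e (k + Suc n)\<bar> = \<bar>of_int (d (k + Suc n))\<bar> * (fact n / fact (k + Suc n))"
        by (simp only: e_def abs_mult abs_divide abs_of_nonneg[OF fact_ge_zero]) simp
      also have "\<dots> \<le> D * (1 / (real n + 1) ^ Suc k)"
      proof (rule mult_mono)
        show "(fact n / fact (k + Suc n) :: real) \<le> 1 / (real n + 1) ^ Suc k"
          using fact_le[of k] by (simp add: divide_simps del: fact_Suc power_Suc)
        show "\<bar>real_of_int (d (k + Suc n))\<bar> \<le> D" using bd by (metis of_int_abs of_int_le_iff)
      qed (use Dn in auto)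
      finally show ?thesis by (simp add: q_def power_divide)
    qed
    moreover have geo: "(\<lambda>k. D * q * q ^ k) sums (D * q * (1 / (1 - q)))"
      using q by (intro sums_mult geometric_sums) auto
    ultimately have "\<bar>\<Sum>k. fact n * e (k + Suc n)\<bar> \<le> D * q * (1 / (1 - q))"
      using suminf_le[OF _ _ sums_summable[OF geo], of "\<lambda>k. \<bar>fact n * e (k + Suc n)\<bar>"]
        summable_comparison_test'[OF sums_summable[OF geo], of 0 "\<lambda>k. \<bar>fact n * e (k + Suc n)\<bar>"]
        summable_rabs[of "\<lambda>k. fact n * e (k + Suc n)"] sums_unique[OF geo] by force
    also have "\<dots> = D / n"
    proof -
      have "q * (1 / (1 - q)) = 1 / n" using n by (simp add: q_def divide_simps)
      then show ?thesis by (metis mult.assoc mult.right_neutral times_divide_eq_right)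
    qed
    also have "\<dots> < 1" using Dn n by (simp add: field_simps)
    finally have small: "\<bar>fact n * R n\<bar> < 1"
      unfolding R_def using suminf_mult[OF summ_tail[of "Suc n"], of "fact n"] by simp
    have "of_int c = (\<Sum>k. e k)" unfolding e_def by (rule sums_unique[OF sums])
    also have "\<dots> = R n + (\<Sum>k<Suc n. e k)" unfolding R_def by (rule suminf_split_initial_segment[OF summ])
    finally have "fact n * R n = fact n * of_int c - (\<Sum>k<Suc n. fact n * e k)"
      by (simp add: algebra_simps sum_distrib_left)
    also have "\<dots> \<in> \<int>"
    proof (rule Ints_diff[OF _ Ints_sum])
      fix k assume "k \<in> {..<Suc n}"
      then have "(fact k :: int) dvd fact n" by (intro fact_dvd) simp
      then obtain m :: int where "fact n = fact k * m" by (auto simp: dvd_def)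
      then have "real_of_int (fact n) = real_of_int (fact k * m)" by simp
      then have "fact n * e k = of_int (m * d k)" by (simp add: e_def field_simps)
      then show "fact n * e k \<in> \<int>" by (metis Ints_of_int)
    qed (simp add: fact_in_Ints)
    finally have "fact n * R n = 0" by (rule Ints_nonzero_abs_less1[OF _ small])
    then show ?thesis by simp
  qed
  show "\<forall>\<^sub>F n in sequentially. d n = 0"
  proof (rule eventually_sequentiallyI)
    fix n assume n: "n \<ge> Suc (Suc (nat D))"
    then obtain m where m: "n = Suc m" "m > nat D" by (cases n) auto
    \<comment> \<open>Two consecutive tails differ by exactly one term, and both vanish.\<close>
    have "R m = R (Suc m) + (\<Sum>k<1. e (k + Suc m))"
      unfolding R_def using suminf_split_initial_segment[OF summ_tail[of "Suc m"], of 1] by simp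
    then have "e n = 0" using R_zero m by simp
    then show "d n = 0" by (simp add: e_def)
  qed
qed

section \<open>An almost disjoint family of continuum many sets of naturals\<close>

definition dyadic_code :: "real \<Rightarrow> nat set" where
  "dyadic_code r = range (\<lambda>k::nat. to_nat (k, \<lfloor>r * 2 ^ k\<rfloor>))"

lemma infinite_dyadic_code: "infinite (dyadic_code r)"
  unfolding dyadic_code_def by (rule range_inj_infinite) (auto simp: inj_def)

text \<open>Each code stores the level together with the dyadic floor, so a common element forces
  equal floors at the same level. Once \<open>2 ^ k\<close> exceeds
  \<open>1 / \<bar>r - s\<bar>\<close> the two floors differ, which leaves only finitely many
  levels.\<close>

lemma finite_dyadic_code_Int:
  assumes "r \<noteq> s" shows "finite (dyadic_code r \<inter> dyadic_code s)"
proof -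
  obtain K :: nat where K: "1 / \<bar>r - s\<bar> < 2 ^ K" using real_arch_pow[of 2 "1 / \<bar>r - s\<bar>"] by auto
  have neq: "\<lfloor>r * 2 ^ k\<rfloor> \<noteq> \<lfloor>s * 2 ^ k\<rfloor>" if "k \<ge> K" for k
  proof
    assume "\<lfloor>r * 2 ^ k\<rfloor> = \<lfloor>s * 2 ^ k\<rfloor>"
    then have "\<bar>r * 2 ^ k - s * 2 ^ k\<bar> < 1" by linarith
    moreover have "\<bar>r * 2 ^ k - s * 2 ^ k\<bar> = \<bar>r - s\<bar> * 2 ^ k" by (simp add: abs_mult flip: left_diff_distrib)
    moreover have "(2::real) ^ K \<le> 2 ^ k" using that by (intro power_increasing) auto
    ultimately have "\<bar>r - s\<bar> * 2 ^ K < 1" using mult_left_mono[of "2 ^ K" "2 ^ k" "\<bar>r - s\<bar>"] by linarith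
    with K assms show False by (simp add: field_simps)
  qed
  have "dyadic_code r \<inter> dyadic_code s \<subseteq> (\<lambda>k. to_nat (k, \<lfloor>r * 2 ^ k\<rfloor>)) ` {..<K}"
  proof
    fix n assume "n \<in> dyadic_code r \<inter> dyadic_code s"
    then obtain k l where "n = to_nat (k, \<lfloor>r * 2 ^ k\<rfloor>)" "n = to_nat (l, \<lfloor>s * 2 ^ l\<rfloor>)"
      by (auto simp: dyadic_code_def)
    with neq[of k] show "n \<in> (\<lambda>k. to_nat (k, \<lfloor>r * 2 ^ k\<rfloor>)) ` {..<K}" by (cases "k < K") auto
  qed
  then show ?thesis by (rule finite_subset) simp
qed

definition lacunary :: "real \<Rightarrow> real" where
  "lacunary r = (\<Sum>n. indicator (dyadic_code r) n / fact n)"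

lemma lacunary_sums: "(\<lambda>n. indicator (dyadic_code r) n / fact n :: real) sums lacunary r"
  unfolding lacunary_def
proof (rule summable_sums, rule summable_comparison_test')
  show "summable (\<lambda>n. inverse (fact n) :: real)" using summable_exp[of 1] by simp
  show "\<And>n. norm (indicator (dyadic_code r) n / fact n :: real) \<le> inverse (fact n)"
    by (simp add: indicator_def divide_simps)
qed

text \<open>An integer relation is a factorial series with bounded integer coefficients and integer
  sum, so its coefficients \<open>d n\<close> vanish from some point on. At a large \<open>n\<close>
  lying in the set of \<open>r\<close> and in no other set of the family, \<open>d n\<close> is just
  \<open>c r\<close>.\<close>

lemma lacunary_independent:
  fixes c :: "real \<Rightarrow> int"
  assumes "finite S" and eq: "(\<Sum>r\<in>S. of_int (c r) * lacunary r) = of_int c0" and "r \<in> S"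
  shows "c r = 0"
proof -
  define d where "d n = (\<Sum>r\<in>S. c r * indicator (dyadic_code r) n)" for n
  have "(\<lambda>n. \<Sum>r\<in>S. of_int (c r) * (indicator (dyadic_code r) n / fact n)) sums (\<Sum>r\<in>S. of_int (c r) * lacunary r)"
    by (intro sums_sum sums_mult lacunary_sums)
  moreover have "(\<lambda>n. \<Sum>r\<in>S. of_int (c r) * (indicator (dyadic_code r) n / fact n)) = (\<lambda>n. of_int (d n) / fact n :: real)"
    by (simp add: d_def sum_divide_distrib indicator_def)
  ultimately have sums: "(\<lambda>n. of_int (d n) / fact n :: real) sums of_int c0" using eq by simp
  have "\<bar>d n\<bar> \<le> (\<Sum>r\<in>S. \<bar>c r\<bar>)" for n
    unfolding d_def by (rule order_trans[OF sum_abs sum_mono]) (simp add: abs_mult indicator_def)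
  from factorial_series_int_coeffs_eventually_zero[OF this sums]
  obtain N where N: "\<And>n. n \<ge> N \<Longrightarrow> d n = 0" by (auto simp: eventually_sequentially)
  \<comment> \<open>By almost disjointness only finitely many elements of the code of
    \<open>r\<close> are shared or lie below \<open>N\<close>; any other element isolates
    \<open>c r\<close>.\<close>
  have "finite ((\<Union>s\<in>S - {r}. dyadic_code r \<inter> dyadic_code s) \<union> {..<N})"
    using \<open>finite S\<close> finite_dyadic_code_Int by (intro finite_UnI finite_UN_I) auto
  then have "\<not> dyadic_code r \<subseteq> (\<Union>s\<in>S - {r}. dyadic_code r \<inter> dyadic_code s) \<union> {..<N}"
    using infinite_dyadic_code finite_subset by blast
  then obtain n where n: "n \<in> dyadic_code r" "\<And>s. s \<in> S - {r} \<Longrightarrow> n \<notin> dyadic_code s" "n \<ge> N" by fastforce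
  have "d n = c r * indicator (dyadic_code r) n + (\<Sum>s\<in>S - {r}. c s * indicator (dyadic_code s) n)"
    unfolding d_def by (rule sum.remove) fact+
  also have "(\<Sum>s\<in>S - {r}. c s * indicator (dyadic_code s) n) = 0"
    using n(2) by (intro sum.neutral) (simp add: indicator_def)
  finally show ?thesis using n N by simp
qed

lemma lacunary_inj: "inj lacunary"
proof (rule injI, rule ccontr)
  fix r s assume *: "lacunary r = lacunary s" "r \<noteq> s"
  have "(\<Sum>t\<in>{r, s}. of_int ((\<lambda>t. if t = r then 1 else -1) t) * lacunary t) = of_int 0"
    using * by simp
  from lacunary_independent[OF _ this, of r] show False by simp
qed

text \<open>Kronecker's theorem with a multiplier that is a natural number beyond any given
  \<open>M\<close>. The theorem itself gives some integer \<open>k\<close>; adding a large multiple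
  of a \<open>q\<close> for which all \<open>q * \<theta> i\<close> are nearly integers, by
  Dirichlet's theorem, makes it large and hardly changes the approximation.\<close>

lemma lacunary_multiples_dense:
  fixes \<alpha> :: "real \<Rightarrow> real" and M :: nat
  assumes "finite J" "\<epsilon> > 0"
  obtains n m where "n \<ge> M" "\<And>r. r \<in> J \<Longrightarrow> \<bar>real n * lacunary r - of_int (m r) - \<alpha> r\<bar> < \<epsilon>"
proof -
  \<comment> \<open>The reals as a module over the integers, so that \<open>independent\<close>
    means the absence of nontrivial integer relations.\<close>
  interpret Modules.module "(\<lambda>r. (*) (real_of_int r))"
    by (simp add: Modules.module.intro distrib_left mult.commute)
  obtain g where g: "bij_betw g {..<card J} J" using ex_bij_betw_nat_finite[OF \<open>finite J\<close>] atLeast0LessThan by metis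
  \<comment> \<open>The entry 1 at index \<open>card J\<close> makes independence also exclude
    relations with an integer constant, as approximation modulo integers demands.\<close>
  define \<theta> where "\<theta> i = (if i < card J then lacunary (g i) else 1)" for i
  have gJ: "g i \<in> J" if "i < card J" for i using g that by (auto simp: bij_betw_def)
  have not1: "lacunary r \<noteq> 1" for r
    using lacunary_independent[of "{r}" "\<lambda>_. 1" 1 r] by auto
  have inj: "inj_on \<theta> {..card J}"
  proof (rule inj_onI)
    fix i k assume ik: "i \<in> {..card J}" "k \<in> {..card J}" "\<theta> i = \<theta> k"
    show "i = k"
    proof (cases "i < card J \<and> k < card J")
      case True
      then have "g i = g k" using ik lacunary_inj by (auto simp: \<theta>_def inj_eq)
      then show ?thesis using g True by (auto simp: bij_betw_def inj_on_def)
    qed (use ik not1 not1[symmetric] in \<open>auto simp: \<theta>_def split: if_splits\<close>)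
  qed
  have indep: "independent (\<theta> ` {..card J})"
    unfolding independent_explicit_module
  proof (intro allI impI)
    fix t u v assume t: "finite t" "t \<subseteq> \<theta> ` {..card J}" and eq: "(\<Sum>v\<in>t. real_of_int (u v) * v) = 0" and v: "v \<in> t"
    define w where "w x = (if x \<in> t then u x else 0)" for x
    have "(\<Sum>v\<in>t. real_of_int (u v) * v) = (\<Sum>v\<in>\<theta> ` {..card J}. real_of_int (w v) * v)"
      using t by (intro sum.mono_neutral_cong_left) (auto simp: w_def)
    also have "\<dots> = (\<Sum>i\<le>card J. real_of_int (w (\<theta> i)) * \<theta> i)" using inj by (simp add: sum.reindex)
    also have "\<dots> = (\<Sum>i<card J. real_of_int (w (lacunary (g i))) * lacunary (g i)) + w 1"
      by (simp add: lessThan_Suc_atMost[symmetric] \<theta>_def)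
    also have "(\<Sum>i<card J. real_of_int (w (lacunary (g i))) * lacunary (g i)) = (\<Sum>r\<in>J. real_of_int (w (lacunary r)) * lacunary r)"
      using g by (rule sum.reindex_bij_betw)
    finally have sum: "(\<Sum>r\<in>J. real_of_int (w (lacunary r)) * lacunary r) = of_int (- w 1)" using eq by simp
    have 0: "w (lacunary r) = 0" if "r \<in> J" for r
      using lacunary_independent[OF \<open>finite J\<close> sum that] .
    moreover from sum have "w 1 = 0" using 0 by simp
    moreover obtain i where "v = \<theta> i" "i \<le> card J" using t v by auto
    ultimately have "w v = 0" using gJ by (auto simp: \<theta>_def)
    then show "u v = 0" using v by (simp add: w_def)
  qed
  obtain k m where km: "\<And>i. i < card J \<Longrightarrow> \<bar>of_int k * \<theta> i - of_int (m i) - \<alpha> (g i)\<bar> < \<epsilon> / 2"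
    using Kronecker_thm_2[OF indep inj, of "\<epsilon> / 2" "\<lambda>i. \<alpha> (g i)"] \<open>\<epsilon> > 0\<close> by (auto simp: \<theta>_def)
  \<comment> \<open>Since \<open>K\<close> exceeds \<open>\<bar>k\<bar> + M\<close> and
    \<open>q\<close> is at least 1, \<open>k + K * q\<close> is at least \<open>M\<close>. The
    number \<open>B\<close> below is chosen so that \<open>K\<close> times the Dirichlet error
    \<open>1 / B\<close> stays under \<open>\<epsilon> / 2\<close>.\<close>
  define K where "K = nat \<bar>k\<bar> + M + 1"
  have K: "real K > 0" by (simp add: K_def)
  obtain B :: nat where B: "B > 0" "1 / B < \<epsilon> / (2 * K)"
    using real_arch_inverse[of "\<epsilon> / (2 * K)"] K \<open>\<epsilon> > 0\<close> by (auto simp: inverse_eq_divide)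
  obtain q p where q: "q > 0" and qp: "\<And>i. i < card J \<Longrightarrow> \<bar>of_int q * \<theta> i - of_int (p i)\<bar> < 1 / B"
    using Dirichlet_approx_simult[OF B(1), of "card J" \<theta>] by metis
  define n where "n = k + int K * q"
  have n: "n \<ge> int M"
  proof -
    have "int K * 1 \<le> int K * q" using q by (intro mult_left_mono) auto
    then show ?thesis by (simp add: n_def K_def)
  qed
  show ?thesis
  proof
    show "nat n \<ge> M" using n by simp
    fix r assume "r \<in> J"
    then obtain i where i: "i < card J" "r = g i" using g by (auto simp: bij_betw_def)
    \<comment> \<open>The integer parts are indexed by positions, while the conclusion asks for a
      function of \<open>r\<close>; the inverse of the enumeration translates.\<close>
    define mm where "mm r = (let i = the_inv_into {..<card J} g r in m i + int K * p i)" for r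
    have "the_inv_into {..<card J} g r = i" using g i by (auto simp: bij_betw_def the_inv_into_f_f)
    then have mr: "mm r = m i + int K * p i" by (simp add: mm_def)
    have "\<bar>K * (of_int q * \<theta> i - of_int (p i))\<bar> < \<epsilon> / 2"
    proof -
      have "K * \<bar>of_int q * \<theta> i - of_int (p i)\<bar> < K * (\<epsilon> / (2 * K))"
        using qp[OF i(1)] B K by (intro mult_strict_left_mono) auto
      also have "\<dots> = \<epsilon> / 2" using K by simp
      finally show ?thesis by (simp add: abs_mult)
    qed
    moreover have "real (nat n) * lacunary r - of_int (mm r) - \<alpha> r =
        (of_int k * \<theta> i - of_int (m i) - \<alpha> (g i)) + K * (of_int q * \<theta> i - of_int (p i))"
    proof -
      have "\<theta> i = lacunary r" "\<alpha> (g i) = \<alpha> r" using i by (auto simp: \<theta>_def)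
      moreover have "real (nat n) = of_int k + K * of_int q" using n by (simp add: n_def)
      ultimately show ?thesis by (simp add: mr algebra_simps)
    qed
    ultimately have "\<bar>real (nat n) * lacunary r - of_int (mm r) - \<alpha> r\<bar> < \<epsilon>" using km[OF i(1)] by linarith
    then show "\<bar>real (nat n) * lacunary r - of_int ((\<lambda>r. let i = the_inv_into {..<card J} g r in m i + int K * p i) r) - \<alpha> r\<bar> < \<epsilon>"
      by (simp add: mm_def)
  qed
qed

section \<open>Characters of the algebra\<close>

lemma ess_bounded_rep_linf: "ess_bounded (rep_linf g)"
  using Quotient3_rep_reflp[OF Quotient3_linf, of g] by (simp add: linf_rel_def)

lemma rep_abs_linf: "ess_bounded f \<Longrightarrow> AE z in circle_measure. rep_linf (abs_linf f) z = f z"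
  using rep_abs_rsp_left[OF Quotient3_linf, of f f] by (simp add: linf_rel_def)

lemma linf_eqI: "(AE z in circle_measure. rep_linf f z = rep_linf g z) \<Longrightarrow> f = g"
  using Quotient3_rel_rep[OF Quotient3_linf, of f g]
  by (simp add: linf_rel_def ess_bounded_rep_linf)

lemma rep_linf_measurable [measurable]: "rep_linf g \<in> borel_measurable circle_measure"
  using ess_bounded_rep_linf by (simp add: ess_bounded_def)

lemma rep_linf_bound: obtains B where "AE z in circle_measure. norm (rep_linf g z) \<le> B"
  using ess_bounded_rep_linf by (auto simp: ess_bounded_def)

lemma rep_linf_zero: "AE z in circle_measure. rep_linf 0 z = 0"
  unfolding zero_linf_def by (rule rep_abs_linf) (rule ess_bounded_const)

lemma rep_linf_one: "AE z in circle_measure. rep_linf 1 z = 1"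
  unfolding one_linf_def by (rule rep_abs_linf) (rule ess_bounded_const)

lemma rep_linf_add: "AE z in circle_measure. rep_linf (f + g) z = rep_linf f z + rep_linf g z"
  unfolding plus_linf_def map_fun_def o_def id_def
  by (rule rep_abs_linf) (intro ess_bounded_add ess_bounded_rep_linf)

lemma rep_linf_mult: "AE z in circle_measure. rep_linf (f * g) z = rep_linf f z * rep_linf g z"
  unfolding times_linf_def map_fun_def o_def id_def
  by (rule rep_abs_linf) (intro ess_bounded_mult ess_bounded_rep_linf)

lemma rep_linf_scale: "AE z in circle_measure. rep_linf (linf_scale c f) z = c * rep_linf f z"
  unfolding linf_scale_def map_fun_def o_def id_def
  by (rule rep_abs_linf) (intro ess_bounded_mult ess_bounded_rep_linf ess_bounded_const)

lemma rep_linf_diff: "AE z in circle_measure. rep_linf (f - g) z = rep_linf f z - rep_linf g z"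
  using rep_linf_add[of "f - g" g] by eventually_elim simp

lemma linf_charactersD:
  assumes "\<phi> \<in> linf_characters"
  shows "\<phi> (f + g) = \<phi> f + \<phi> g" "\<phi> (linf_scale c f) = c * \<phi> f" "\<phi> (f * g) = \<phi> f * \<phi> g"
    and "\<phi> 1 = 1" "\<phi> (f - g) = \<phi> f - \<phi> g"
proof -
  show add: "\<phi> (f + g) = \<phi> f + \<phi> g" and "\<phi> (linf_scale c f) = c * \<phi> f"
    and mult: "\<phi> (f * g) = \<phi> f * \<phi> g" for f g c
    using assms by (auto simp: linf_characters_def)
  show "\<phi> (f - g) = \<phi> f - \<phi> g" using add[of "f - g" g] by simp
  obtain h where "\<phi> h \<noteq> 0" using assms by (auto simp: linf_characters_def fun_eq_iff)
  then show "\<phi> 1 = 1" using mult[of 1 h] by simp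
qed

text \<open>The condition \<open>\<phi> 1 = 1\<close> stands in for nonvanishing because, like the
  algebraic identities, it is closed under pointwise limits.\<close>

lemma linf_charactersI:
  assumes "\<And>f g. \<phi> (f + g) = \<phi> f + \<phi> g" "\<And>c f. \<phi> (linf_scale c f) = c * \<phi> f"
    and "\<And>f g. \<phi> (f * g) = \<phi> f * \<phi> g" "\<phi> 1 = 1"
  shows "\<phi> \<in> linf_characters"
proof -
  have "\<phi> \<noteq> (\<lambda>_. 0)" using assms(4) by (metis zero_neq_one)
  with assms show ?thesis by (auto simp: linf_characters_def)
qed

text \<open>Off the essential range of \<open>g\<close> the element \<open>g - c\<close> is invertible, so no character maps it to \<open>0\<close>.\<close>
lemma character_in_closed:
  assumes \<phi>: "\<phi> \<in> linf_characters" and "closed S" and S: "AE z in circle_measure. rep_linf g z \<in> S"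
  shows "\<phi> g \<in> S"
proof (rule ccontr)
  define c where "c = \<phi> g"
  assume "\<phi> g \<notin> S"
  then obtain \<delta> where \<delta>: "\<delta> > 0" "\<And>w. w \<in> S \<Longrightarrow> dist c w \<ge> \<delta>"
    using \<open>closed S\<close> by (metis c_def closed_approachable dist_commute not_less)
  define f where "f = g - linf_scale c 1"
  have f: "AE z in circle_measure. rep_linf f z = rep_linf g z - c"
    unfolding f_def using rep_linf_diff[of g "linf_scale c 1"] rep_linf_scale[of c 1] rep_linf_one
    by eventually_elim simp
  \<comment> \<open>The reciprocal of \<open>f\<close>, cut off to be bounded by
    \<open>1 / \<delta>\<close> everywhere. The cut-off takes effect only on a null set, since
    \<open>f\<close> almost everywhere has modulus at least \<open>\<delta>\<close>.\<close>
  define h where "h z = (if \<delta> \<le> norm (rep_linf f z) then inverse (rep_linf f z) else 0)" for z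
  have "ess_bounded h"
    unfolding ess_bounded_def
  proof (intro conjI exI[of _ "1 / \<delta>"] AE_I2)
    show "h \<in> borel_measurable circle_measure" unfolding h_def by measurable
    show "norm (h z) \<le> 1 / \<delta>" for z
    proof (cases "\<delta> \<le> norm (rep_linf f z)")
      case True
      then have "inverse (norm (rep_linf f z)) \<le> inverse \<delta>" using \<delta>(1) by (rule le_imp_inverse_le)
      then show ?thesis using True by (simp add: h_def norm_inverse inverse_eq_divide[of \<delta>])
    qed (use \<delta>(1) in \<open>simp add: h_def\<close>)
  qed
  then have h: "AE z in circle_measure. rep_linf (abs_linf h) z = h z" by (rule rep_abs_linf)
  have "f * abs_linf h = 1"
  proof (rule linf_eqI)
    show "AE z in circle_measure. rep_linf (f * abs_linf h) z = rep_linf 1 z"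
      using rep_linf_mult[of f "abs_linf h"] h S f rep_linf_one
    proof eventually_elim
      case (elim z)
      then have "\<delta> \<le> norm (rep_linf f z)" using \<delta>(2)[of "rep_linf g z"] by (simp add: dist_norm norm_minus_commute)
      moreover from this \<delta>(1) have "rep_linf f z \<noteq> 0" by auto
      ultimately show ?case using elim(1,2,5) by (simp add: h_def)
    qed
  qed
  then have "\<phi> f * \<phi> (abs_linf h) = 1" using linf_charactersD[OF \<phi>] by metis
  moreover have "\<phi> f = 0" by (simp add: f_def linf_charactersD[OF \<phi>] c_def)
  ultimately show False by simp
qed

lemma character_bound:
  assumes "\<phi> \<in> linf_characters" "AE z in circle_measure. norm (rep_linf g z) \<le> B"
  shows "norm (\<phi> g) \<le> B"
  using character_in_closed[OF assms(1) closed_cball, of g 0 B] assms(2) by simp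

lemma closed_character_conditions:
  "closed {\<phi> :: linf \<Rightarrow> complex. \<phi> (f + g) = \<phi> f + \<phi> g}"
  "closed {\<phi> :: linf \<Rightarrow> complex. \<phi> (linf_scale c f) = c * \<phi> f}"
  "closed {\<phi> :: linf \<Rightarrow> complex. \<phi> (f * g) = \<phi> f * \<phi> g}"
  "closed {\<phi> :: linf \<Rightarrow> complex. \<phi> 1 = 1}"
  by (intro closed_Collect_eq continuous_on_add continuous_on_mult continuous_on_const
      continuous_on_product_coordinates)+

lemma closed_linf_characters: "closed linf_characters"
proof -
  have "linf_characters = {\<phi>. (\<forall>f g. \<phi> (f + g) = \<phi> f + \<phi> g) \<and> (\<forall>c f. \<phi> (linf_scale c f) = c * \<phi> f)
      \<and> (\<forall>f g. \<phi> (f * g) = \<phi> f * \<phi> g) \<and> \<phi> 1 = 1}"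
    using linf_charactersD linf_charactersI by blast
  also have "closed \<dots>"
    by (intro closed_Collect_conj closed_Collect_all closed_character_conditions)
  finally show ?thesis .
qed

lemma compact_PiE_cball: "compact (PiE UNIV (\<lambda>f. cball (0::complex) (B f)))"
proof -
  have "compactin (product_topology (\<lambda>_. euclidean) UNIV) (PiE UNIV (\<lambda>f. cball (0::complex) (B f)))"
    by (subst compactin_PiE) simp
  then show ?thesis by (simp add: euclidean_product_topology)
qed

lemma linf_bound_fun:
  obtains B where "\<And>g. AE z in circle_measure. norm (rep_linf g z) \<le> B g" "\<And>g. B g \<ge> 0"
proof -
  have "\<exists>B\<ge>0. AE z in circle_measure. norm (rep_linf g z) \<le> B" for g
  proof -
    obtain B where "AE z in circle_measure. norm (rep_linf g z) \<le> B" by (rule rep_linf_bound)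
    then have "AE z in circle_measure. norm (rep_linf g z) \<le> max 0 B" by eventually_elim simp
    then show ?thesis by (intro exI[of _ "max 0 B"]) simp
  qed
  then show ?thesis using that by metis
qed

text \<open>The Banach-Alaoglu argument: the characters form a closed subset of a product of discs,
  which is compact by Tychonoff's theorem.\<close>

lemma compact_linf_characters: "compact linf_characters"
proof -
  obtain B where B: "\<And>g. AE z in circle_measure. norm (rep_linf g z) \<le> B g" by (rule linf_bound_fun) blast
  have "linf_characters \<subseteq> PiE UNIV (\<lambda>f. cball 0 (B f))" using character_bound B by fastforce
  then show ?thesis
    using compact_Int_closed[OF compact_PiE_cball closed_linf_characters, of B] by (simp add: Int_absorb1)
qed

text \<open>
  The representatives evaluated along the filter stay in a product of compact discs, and any cluster
  point of these evaluations is a character.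
\<close>
lemma character_along_filter:
  assumes "F \<noteq> bot" "F \<le> ae_filter circle_measure"
  obtains \<phi> where "\<phi> \<in> linf_characters"
    and "\<And>g S. closed S \<Longrightarrow> eventually (\<lambda>z. rep_linf g z \<in> S) F \<Longrightarrow> \<phi> g \<in> S"
proof -
  have ev: "eventually P F" if "AE z in circle_measure. P z" for P using that assms(2) by (auto simp: le_filter_def)
  obtain B where B: "\<And>g. AE z in circle_measure. norm (rep_linf g z) \<le> B g" "\<And>g. B g \<ge> 0" by (rule linf_bound_fun) blast
  \<comment> \<open>The bound for \<open>g\<close> may fail on a null set depending on
    \<open>g\<close>, and there are uncountably many \<open>g\<close>. Replacing bad values by 0
    places \<open>p z\<close> in the product for every \<open>z\<close> and changes each coordinate
    only on a null set.\<close>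
  define p where "p z = (\<lambda>g. if norm (rep_linf g z) \<le> B g then rep_linf g z else 0)" for z
  have p: "eventually (\<lambda>z. p z g = rep_linf g z) F" for g
    using ev[OF B(1)[of g]] by eventually_elim (simp add: p_def)
  have "p z \<in> PiE UNIV (\<lambda>f. cball 0 (B f))" for z using B(2) by (auto simp: p_def)
  then have "eventually (\<lambda>x. x \<in> PiE UNIV (\<lambda>f. cball 0 (B f))) (filtermap p F)"
    by (simp add: eventually_filtermap)
  moreover have "filtermap p F \<noteq> bot" using assms(1) by (simp add: filtermap_bot_iff)
  ultimately obtain \<phi> where \<phi>: "inf (nhds \<phi>) (filtermap p F) \<noteq> bot"
    using compact_PiE_cball[of B] unfolding compact_filter by blast
  \<comment> \<open>A cluster point belongs to every closed set that eventually contains the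
    evaluations. All conditions required of \<open>\<phi>\<close> are of this kind.\<close>
  have inC: "\<phi> \<in> C" if "closed C" "eventually (\<lambda>z. p z \<in> C) F" for C
  proof (rule ccontr)
    assume "\<phi> \<notin> C"
    then have "eventually (\<lambda>x. x \<in> - C) (nhds \<phi>)" using that(1) by (intro eventually_nhds_in_open) auto
    moreover have "eventually (\<lambda>x. x \<in> C) (filtermap p F)" using that(2) by (simp add: eventually_filtermap)
    ultimately have "eventually (\<lambda>_. False) (inf (nhds \<phi>) (filtermap p F))"
      unfolding eventually_inf by blast
    with \<phi> show False by (simp add: trivial_limit_def)
  qed
  show ?thesis
  proof
    show "\<phi> \<in> linf_characters"
    proof (rule linf_charactersI)
      fix f g c
      have "\<phi> \<in> {\<phi>. \<phi> (f + g) = \<phi> f + \<phi> g}"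
        by (rule inC[OF closed_character_conditions(1)])
          (use p[of "f + g"] p[of f] p[of g] ev[OF rep_linf_add[of f g]] in eventually_elim, simp)
      then show "\<phi> (f + g) = \<phi> f + \<phi> g" by simp
      have "\<phi> \<in> {\<phi>. \<phi> (f * g) = \<phi> f * \<phi> g}"
        by (rule inC[OF closed_character_conditions(3)])
          (use p[of "f * g"] p[of f] p[of g] ev[OF rep_linf_mult[of f g]] in eventually_elim, simp)
      then show "\<phi> (f * g) = \<phi> f * \<phi> g" by simp
      have "\<phi> \<in> {\<phi>. \<phi> (linf_scale c f) = c * \<phi> f}"
        by (rule inC[OF closed_character_conditions(2)])
          (use p[of "linf_scale c f"] p[of f] ev[OF rep_linf_scale[of c f]] in eventually_elim, simp)
      then show "\<phi> (linf_scale c f) = c * \<phi> f" by simp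
      have "\<phi> \<in> {\<phi>. \<phi> 1 = 1}"
        by (rule inC[OF closed_character_conditions(4)])
          (use p[of 1] ev[OF rep_linf_one] in eventually_elim, simp)
      then show "\<phi> 1 = 1" by simp
    qed
    fix g and S :: "complex set" assume S: "closed S" "eventually (\<lambda>z. rep_linf g z \<in> S) F"
    have "closed ((\<lambda>\<phi>. \<phi> g) -` S :: (linf \<Rightarrow> complex) set)"
      by (rule closed_vimage[OF S(1) continuous_on_product_coordinates])
    then have "\<phi> \<in> (\<lambda>\<phi>. \<phi> g) -` S"
      by (rule inC) (use S(2) p[of g] in eventually_elim, simp)
    then show "\<phi> g \<in> S" by simp
  qed
qed

text \<open>Converse of \<open>character_in_closed\<close>. The complement of \<open>S\<close> is a
  countable union of closed boxes. If \<open>g\<close> took values in such a box \<open>K\<close> on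
  a set that is not null, the almost everywhere filter restricted to that set would be proper and
  would produce a character with value in \<open>K\<close>.\<close>

lemma AE_in_closed_of_characters:
  assumes "closed S" and S: "\<And>\<phi>. \<phi> \<in> linf_characters \<Longrightarrow> \<phi> g \<in> S"
  shows "AE z in circle_measure. rep_linf g z \<in> S"
proof -
  obtain D where D: "countable D" "\<And>K. K \<in> D \<Longrightarrow> \<exists>a b. K = cbox a b" "\<Union>D = - S"
    using open_countable_Union_open_cbox[OF open_Compl[OF \<open>closed S\<close>]] by metis
  have "AE z in circle_measure. rep_linf g z \<notin> K" if "K \<in> D" for K
  proof (rule ccontr)
    assume not: "\<not> (AE z in circle_measure. rep_linf g z \<notin> K)"
    define F where "F = inf (ae_filter circle_measure) (principal {z. rep_linf g z \<in> K})"
    have "F \<noteq> bot"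
    proof
      assume "F = bot"
      then have "eventually (\<lambda>_. False) F" by simp
      with not show False by (simp add: F_def eventually_inf_principal)
    qed
    moreover have "F \<le> ae_filter circle_measure" by (simp add: F_def)
    ultimately obtain \<phi> where \<phi>: "\<phi> \<in> linf_characters"
      "\<And>g S. closed S \<Longrightarrow> eventually (\<lambda>z. rep_linf g z \<in> S) F \<Longrightarrow> \<phi> g \<in> S"
      by (rule character_along_filter) blast
    have "closed K" using D(2)[OF that] by auto
    then have "\<phi> g \<in> K" by (rule \<phi>(2)) (simp add: F_def eventually_inf_principal)
    with S[OF \<phi>(1)] D(3) that show False by blast
  qed
  then have "AE z in circle_measure. \<forall>K\<in>D. rep_linf g z \<notin> K" using D(1) by (simp add: AE_ball_countable)
  then show ?thesis by eventually_elim (use D(3) in auto)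
qed

text \<open>Together with \<open>character_bound\<close> this makes the Gelfand transform
  isometric.\<close>

lemma AE_bound_of_characters:
  assumes "\<And>\<phi>. \<phi> \<in> linf_characters \<Longrightarrow> norm (\<phi> g) \<le> B"
  shows "AE z in circle_measure. norm (rep_linf g z) \<le> B"
  using AE_in_closed_of_characters[OF closed_cball, of g 0 B] assms by simp

text \<open>
  The library version of the Stone--Weierstrass theorem wants a type of class \<^class>\<open>t2_space\<close>, and the
  function type is not an instance. Hence the detour through a copy of it.
\<close>
typedef ('a, 'b) pointwise = "UNIV :: ('a \<Rightarrow> 'b) set"
  morphisms pw_apply Pw ..

instantiation pointwise :: (type, t2_space) t2_space
begin

definition open_pointwise :: "('a, 'b) pointwise set \<Rightarrow> bool" where
  "open_pointwise U \<longleftrightarrow> open (Pw -` U)"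

instance
proof
  show "open (UNIV :: ('a, 'b) pointwise set)" by (simp add: open_pointwise_def)
  show "open (U \<inter> V)" if "open U" "open V" for U V :: "('a, 'b) pointwise set"
    using that by (simp add: open_pointwise_def open_Int)
  show "open (\<Union>K)" if "\<forall>U\<in>K. open U" for K :: "('a, 'b) pointwise set set"
    using that by (auto simp: open_pointwise_def vimage_Union)
  fix f g :: "('a, 'b) pointwise" assume "f \<noteq> g"
  then obtain x where "pw_apply f x \<noteq> pw_apply g x" by (metis ext pw_apply_inject)
  then obtain U V where UV: "open U" "open V" "pw_apply f x \<in> U" "pw_apply g x \<in> V" "U \<inter> V = {}"
    using hausdorff[of "pw_apply f x" "pw_apply g x"] by blast
  have "open ((\<lambda>h. pw_apply h x) -` W)" if "open W" for W
  proof -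
    have "open ((\<lambda>h. h x) -` W :: ('a \<Rightarrow> 'b) set)"
      by (rule open_vimage[OF that continuous_on_product_coordinates])
    then show ?thesis by (simp add: open_pointwise_def vimage_def Pw_inverse)
  qed
  with UV show "\<exists>U V. open U \<and> open V \<and> f \<in> U \<and> g \<in> V \<and> U \<inter> V = {}"
    by (intro exI[of _ "(\<lambda>h. pw_apply h x) -` U"] exI[of _ "(\<lambda>h. pw_apply h x) -` V"]) auto
qed

end

lemma continuous_on_Pw: "continuous_on UNIV Pw"
  by (simp add: continuous_on_open_vimage open_pointwise_def)

lemma continuous_on_pw_apply: "continuous_on UNIV pw_apply"
proof -
  have "Pw -` (pw_apply -` B) = B" for B :: "('a \<Rightarrow> 'b) set" by (auto simp: Pw_inverse)
  then show ?thesis by (simp add: continuous_on_open_vimage open_pointwise_def)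
qed

lemma Stone_Weierstrass_pointwise:
  fixes S :: "('a \<Rightarrow> 'b::t2_space) set"
  assumes "compact S" and const: "\<And>c. P (\<lambda>x. c::real)"
    and cont: "\<And>f. P f \<Longrightarrow> continuous_on S f"
    and add: "\<And>f g. P f \<Longrightarrow> P g \<Longrightarrow> P (\<lambda>x. f x + g x)" and mult: "\<And>f g. P f \<Longrightarrow> P g \<Longrightarrow> P (\<lambda>x. f x * g x)"
    and sep: "\<And>x y. x \<in> S \<Longrightarrow> y \<in> S \<Longrightarrow> x \<noteq> y \<Longrightarrow> \<exists>f. P f \<and> f x \<noteq> f y"
    and F: "continuous_on S F" and "e > 0"
  shows "\<exists>g. P g \<and> (\<forall>x\<in>S. \<bar>F x - g x\<bar> < e)"
proof -
  have comp: "continuous_on (Pw ` S) (\<lambda>x. f (pw_apply x))" if "continuous_on S f" for f :: "('a \<Rightarrow> 'b) \<Rightarrow> real"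
  proof (rule continuous_on_compose2[OF that])
    show "continuous_on (Pw ` S) pw_apply" by (rule continuous_on_subset[OF continuous_on_pw_apply]) simp
  qed (auto simp: Pw_inverse)
  have "\<exists>g. P (\<lambda>x. g (Pw x)) \<and> (\<forall>x\<in>Pw ` S. \<bar>F (pw_apply x) - g x\<bar> < e)"
  proof (rule Stone_Weierstrass_HOL)
    show "compact (Pw ` S)"
      by (rule compact_continuous_image[OF continuous_on_subset[OF continuous_on_Pw] \<open>compact S\<close>]) simp
    show "continuous_on (Pw ` S) f" if "P (\<lambda>x. f (Pw x))" for f
      using comp[OF cont[OF that]] by (simp add: pw_apply_inverse)
    show "\<exists>f. P (\<lambda>x. f (Pw x)) \<and> f x \<noteq> f y" if xy: "x \<in> Pw ` S \<and> y \<in> Pw ` S \<and> x \<noteq> y" for x y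
    proof -
      obtain f where "P f" "f (pw_apply x) \<noteq> f (pw_apply y)"
        using sep[of "pw_apply x" "pw_apply y"] xy by (auto simp: Pw_inverse Pw_inject)
      then show ?thesis by (intro exI[of _ "\<lambda>x. f (pw_apply x)"]) (simp add: Pw_inverse)
    qed
  qed (use const add mult comp[OF F] \<open>e > 0\<close> in auto)
  then show ?thesis by (auto simp: Pw_inverse)
qed

text \<open>The transforms of real-valued elements form a real algebra of continuous functions on
  the compact character space; it contains the constants and separates points, so the
  Stone-Weierstrass theorem applies.\<close>

lemma gelfand_approx_real:
  fixes F :: "(linf \<Rightarrow> complex) \<Rightarrow> real"
  assumes "continuous_on linf_characters F" "e > 0"
  obtains g where "\<And>\<phi>. \<phi> \<in> linf_characters \<Longrightarrow> norm (of_real (F \<phi>) - \<phi> g) < e"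
proof -
  define real_elt where "real_elt g \<longleftrightarrow> (AE z in circle_measure. rep_linf g z \<in> \<real>)" for g
  have real_char: "\<phi> g = of_real (Re (\<phi> g))" if "real_elt g" "\<phi> \<in> linf_characters" for g \<phi>
    using character_in_closed[OF that(2) closed_complex_Reals] that(1) unfolding real_elt_def by fastforce
  define P where "P f \<longleftrightarrow> (\<exists>g. real_elt g \<and> (\<forall>\<phi>\<in>linf_characters. f \<phi> = Re (\<phi> g)))" for f
  have "\<exists>f. P f \<and> (\<forall>x\<in>linf_characters. \<bar>F x - f x\<bar> < e)"
  proof (rule Stone_Weierstrass_pointwise[OF compact_linf_characters _ _ _ _ _ assms(1) assms(2)])
    show "P (\<lambda>_. c)" for c
      unfolding P_def
    proof (intro exI[of _ "linf_scale (of_real c) 1"] conjI ballI)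
      show "real_elt (linf_scale (of_real c) 1)"
        unfolding real_elt_def using rep_linf_scale[of "of_real c" 1] rep_linf_one by eventually_elim simp
    qed (simp add: linf_charactersD)
    show "continuous_on linf_characters f" if "P f" for f
    proof -
      from that obtain g where g: "\<And>\<phi>. \<phi> \<in> linf_characters \<Longrightarrow> f \<phi> = Re (\<phi> g)" by (auto simp: P_def)
      have "continuous_on linf_characters (\<lambda>\<phi>. Re (\<phi> g))"
        by (intro continuous_on_Re continuous_on_subset[OF continuous_on_product_coordinates]) auto
      then show ?thesis using g by (simp cong: continuous_on_cong)
    qed
    show "P (\<lambda>x. f x + h x)" if fh: "P f" "P h" for f h
    proof -
      from fh obtain a b where ab: "real_elt a" "real_elt b" "\<And>\<phi>. \<phi> \<in> linf_characters \<Longrightarrow> f \<phi> = Re (\<phi> a)"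
        "\<And>\<phi>. \<phi> \<in> linf_characters \<Longrightarrow> h \<phi> = Re (\<phi> b)" by (auto simp: P_def)
      have "real_elt (a + b)" using ab(1,2) rep_linf_add[of a b] unfolding real_elt_def by eventually_elim simp
      with ab show ?thesis by (auto simp: P_def linf_charactersD intro!: exI[of _ "a + b"])
    qed
    show "P (\<lambda>x. f x * h x)" if fh: "P f" "P h" for f h
    proof -
      from fh obtain a b where ab: "real_elt a" "real_elt b" "\<And>\<phi>. \<phi> \<in> linf_characters \<Longrightarrow> f \<phi> = Re (\<phi> a)"
        "\<And>\<phi>. \<phi> \<in> linf_characters \<Longrightarrow> h \<phi> = Re (\<phi> b)" by (auto simp: P_def)
      have "real_elt (a * b)" using ab(1,2) rep_linf_mult[of a b] unfolding real_elt_def by eventually_elim simp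
      moreover have "f \<phi> * h \<phi> = Re (\<phi> (a * b))" if "\<phi> \<in> linf_characters" for \<phi>
        using real_char[OF ab(1) that] real_char[OF ab(2) that] ab(3,4)[OF that] linf_charactersD(3)[OF that]
        by (metis Re_complex_of_real of_real_mult)
      ultimately show ?thesis by (auto simp: P_def)
    qed
    show "\<exists>f. P f \<and> f \<phi> \<noteq> f \<psi>" if *: "\<phi> \<in> linf_characters" "\<psi> \<in> linf_characters" "\<phi> \<noteq> \<psi>" for \<phi> \<psi>
    proof -
      from * obtain g where g: "\<phi> g \<noteq> \<psi> g" by (auto simp: fun_eq_iff)
      \<comment> \<open>Two characters that differ at \<open>g\<close> differ at its real or its
        imaginary part. Characters are real at both of these, so taking \<open>Re\<close> loses
        nothing.\<close>
      define a where "a = abs_linf (\<lambda>z. of_real (Re (rep_linf g z)))"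
      define b where "b = abs_linf (\<lambda>z. of_real (Im (rep_linf g z)))"
      obtain B where B: "AE z in circle_measure. norm (rep_linf g z) \<le> B" by (rule rep_linf_bound)
      have "AE z in circle_measure. norm (complex_of_real (Re (rep_linf g z))) \<le> B"
        "AE z in circle_measure. norm (complex_of_real (Im (rep_linf g z))) \<le> B"
        using B by (eventually_elim, simp, metis abs_Re_le_cmod abs_Im_le_cmod order_trans)+
      then have "ess_bounded (\<lambda>z. of_real (Re (rep_linf g z)))" "ess_bounded (\<lambda>z. of_real (Im (rep_linf g z)))"
        unfolding ess_bounded_def by auto
      then have a: "AE z in circle_measure. rep_linf a z = of_real (Re (rep_linf g z))"
        and b: "AE z in circle_measure. rep_linf b z = of_real (Im (rep_linf g z))"
        unfolding a_def b_def by (auto intro: rep_abs_linf)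
      have ra: "real_elt a" using a unfolding real_elt_def by eventually_elim simp
      have rb: "real_elt b" using b unfolding real_elt_def by eventually_elim simp
      have "g = a + linf_scale \<i> b"
        by (rule linf_eqI)
          (use rep_linf_add[of a "linf_scale \<i> b"] rep_linf_scale[of \<i> b] a b in eventually_elim, simp add: complex_eq mult.commute)
      then have "\<xi> g = \<xi> a + \<i> * \<xi> b" if "\<xi> \<in> linf_characters" for \<xi>
        by (simp add: linf_charactersD[OF that])
      then have "\<phi> a \<noteq> \<psi> a \<or> \<phi> b \<noteq> \<psi> b" using g * by metis
      moreover have "P (\<lambda>\<phi>. Re (\<phi> a))" "P (\<lambda>\<phi>. Re (\<phi> b))" using ra rb by (auto simp: P_def)
      moreover have "\<xi> a = of_real (Re (\<xi> a))" "\<xi> b = of_real (Re (\<xi> b))" if "\<xi> \<in> linf_characters" for \<xi>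
        using real_char[OF ra that] real_char[OF rb that] .
      ultimately show ?thesis using *(1,2) by metis
    qed
  qed
  then obtain f g where "real_elt g" and f: "\<And>\<phi>. \<phi> \<in> linf_characters \<Longrightarrow> f \<phi> = Re (\<phi> g)"
    and fe: "\<And>\<phi>. \<phi> \<in> linf_characters \<Longrightarrow> \<bar>F \<phi> - f \<phi>\<bar> < e" unfolding P_def by auto
  show ?thesis
  proof
    fix \<phi> assume \<phi>: "\<phi> \<in> linf_characters"
    have "\<phi> g = of_real (f \<phi>)" using real_char[OF \<open>real_elt g\<close> \<phi>] f[OF \<phi>] by simp
    then show "norm (of_real (F \<phi>) - \<phi> g) < e" using fe[OF \<phi>] by (metis norm_of_real of_real_diff)
  qed
qed

text \<open>Completeness: because the transform is isometric, elements approximating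
  \<open>F\<close> better and better form a Cauchy sequence in essential supremum norm, and the
  transform of the limit is \<open>F\<close>.\<close>

lemma gelfand_surjective:
  fixes F :: "(linf \<Rightarrow> complex) \<Rightarrow> complex"
  assumes "continuous_on linf_characters F"
  obtains g where "\<And>\<phi>. \<phi> \<in> linf_characters \<Longrightarrow> \<phi> g = F \<phi>"
proof -
  have approx: "\<exists>g. \<forall>\<phi>\<in>linf_characters. norm (F \<phi> - \<phi> g) < e" if "e > 0" for e
  proof -
    obtain a where a: "\<And>\<phi>. \<phi> \<in> linf_characters \<Longrightarrow> norm (of_real (Re (F \<phi>)) - \<phi> a) < e / 2"
      using gelfand_approx_real[OF continuous_on_Re[OF assms], of "e / 2"] \<open>e > 0\<close> by auto
    obtain b where b: "\<And>\<phi>. \<phi> \<in> linf_characters \<Longrightarrow> norm (of_real (Im (F \<phi>)) - \<phi> b) < e / 2"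
      using gelfand_approx_real[OF continuous_on_Im[OF assms], of "e / 2"] \<open>e > 0\<close> by auto
    have "norm (F \<phi> - \<phi> (a + linf_scale \<i> b)) < e" if \<phi>: "\<phi> \<in> linf_characters" for \<phi>
    proof -
      have "F \<phi> - \<phi> (a + linf_scale \<i> b) = (of_real (Re (F \<phi>)) - \<phi> a) + \<i> * (of_real (Im (F \<phi>)) - \<phi> b)"
        using complex_eq[of "F \<phi>"] by (simp add: linf_charactersD[OF \<phi>] algebra_simps)
      moreover have "norm (\<i> * (of_real (Im (F \<phi>)) - \<phi> b)) < e / 2" using b[OF \<phi>] by (simp add: norm_mult)
      ultimately show ?thesis using a[OF \<phi>] by (simp add: norm_triangle_lt)
    qed
    then show ?thesis by blast
  qed
  define e where "e n = inverse (real (Suc n))" for n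
  have e0: "e \<longlonglongrightarrow> 0" unfolding e_def by (rule LIMSEQ_inverse_real_of_nat)
  obtain g where g: "\<And>n \<phi>. \<phi> \<in> linf_characters \<Longrightarrow> norm (F \<phi> - \<phi> (g n)) < e n"
  proof -
    have "\<forall>n. \<exists>g. \<forall>\<phi>\<in>linf_characters. norm (F \<phi> - \<phi> g) < e n" by (intro allI approx) (simp add: e_def)
    then show ?thesis using that by metis
  qed
  have "AE z in circle_measure. norm (rep_linf (g n) z - rep_linf (g m) z) \<le> e n + e m" for n m
  proof -
    have "norm (\<phi> (g n - g m)) \<le> e n + e m" if \<phi>: "\<phi> \<in> linf_characters" for \<phi>
    proof -
      have "\<phi> (g n - g m) = (F \<phi> - \<phi> (g m)) - (F \<phi> - \<phi> (g n))" by (simp add: linf_charactersD[OF \<phi>])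
      then have "norm (\<phi> (g n - g m)) \<le> norm (F \<phi> - \<phi> (g m)) + norm (F \<phi> - \<phi> (g n))"
        using norm_triangle_ineq4 by metis
      then show ?thesis using g[OF \<phi>, of n] g[OF \<phi>, of m] by linarith
    qed
    then have "AE z in circle_measure. norm (rep_linf (g n - g m) z) \<le> e n + e m"
      by (rule AE_bound_of_characters)
    then show ?thesis using rep_linf_diff[of "g n" "g m"] by eventually_elim simp
  qed
  \<comment> \<open>Only countably many pairs \<open>n\<close>, \<open>m\<close> occur, so one null
    set serves for all of them and the convergence off it is uniform.\<close>
  then have cauchy: "AE z in circle_measure. \<forall>n m. norm (rep_linf (g n) z - rep_linf (g m) z) \<le> e n + e m"
    unfolding AE_all_countable by blast
  define h where "h z = lim (\<lambda>n. rep_linf (g n) z)" for z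
  have h: "AE z in circle_measure. \<forall>n. norm (h z - rep_linf (g n) z) \<le> e n"
    using cauchy
  proof eventually_elim
    case (elim z)
    have "Cauchy (\<lambda>n. rep_linf (g n) z)"
    proof (rule metric_CauchyI)
      fix d :: real assume "d > 0"
      then obtain N where N: "\<And>n. n \<ge> N \<Longrightarrow> e n < d / 2"
        using order_tendstoD(2)[OF e0, of "d / 2"] by (auto simp: eventually_sequentially)
      show "\<exists>M. \<forall>m\<ge>M. \<forall>n\<ge>M. dist (rep_linf (g m) z) (rep_linf (g n) z) < d"
      proof (intro exI allI impI)
        fix m n assume "N \<le> m" "N \<le> n"
        then show "dist (rep_linf (g m) z) (rep_linf (g n) z) < d"
          using N[of m] N[of n] elim[rule_format, of m n] by (simp add: dist_norm)
      qed
    qed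
    then have lim: "(\<lambda>n. rep_linf (g n) z) \<longlonglongrightarrow> h z"
      by (simp add: h_def convergent_LIMSEQ_iff Cauchy_convergent_iff)
    show ?case
    proof
      fix n
      have "(\<lambda>m. norm (rep_linf (g m) z - rep_linf (g n) z)) \<longlonglongrightarrow> norm (h z - rep_linf (g n) z)"
        by (intro tendsto_intros lim)
      moreover have "(\<lambda>m. e m + e n) \<longlonglongrightarrow> 0 + e n" by (intro tendsto_intros e0)
      ultimately show "norm (h z - rep_linf (g n) z) \<le> e n"
        using elim by (intro LIMSEQ_le[where Y = "\<lambda>m. e m + e n"]) auto
    qed
  qed
  have "ess_bounded h"
  proof -
    obtain B where "AE z in circle_measure. norm (rep_linf (g 0) z) \<le> B" by (rule rep_linf_bound)
    then have "AE z in circle_measure. norm (h z) \<le> B + e 0"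
      using h
    proof eventually_elim
      case (elim z)
      then show ?case using elim(2)[rule_format, of 0] norm_triangle_sub[of "h z" "rep_linf (g 0) z"] by linarith
    qed
    then show ?thesis unfolding ess_bounded_def h_def by auto
  qed
  then have rep: "AE z in circle_measure. rep_linf (abs_linf h) z = h z" by (rule rep_abs_linf)
  show ?thesis
  proof
    fix \<phi> assume \<phi>: "\<phi> \<in> linf_characters"
    have "norm (\<phi> (abs_linf h) - F \<phi>) \<le> 2 * e n" for n
    proof -
      have "AE z in circle_measure. norm (rep_linf (abs_linf h - g n) z) \<le> e n"
        using rep rep_linf_diff[of "abs_linf h" "g n"] h by eventually_elim simp
      then have "norm (\<phi> (abs_linf h - g n)) \<le> e n" by (rule character_bound[OF \<phi>])
      moreover have "\<phi> (abs_linf h) - F \<phi> = \<phi> (abs_linf h - g n) - (F \<phi> - \<phi> (g n))"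
        by (simp add: linf_charactersD[OF \<phi>])
      ultimately have "norm (\<phi> (abs_linf h) - F \<phi>) \<le> norm (\<phi> (abs_linf h - g n)) + norm (F \<phi> - \<phi> (g n))"
        using norm_triangle_ineq4 by metis
      then show ?thesis using g[OF \<phi>, of n] \<open>norm (\<phi> (abs_linf h - g n)) \<le> e n\<close> by linarith
    qed
    moreover have "(\<lambda>n. 2 * e n) \<longlonglongrightarrow> 2 * 0" by (intro tendsto_intros e0)
    ultimately have "norm (\<phi> (abs_linf h) - F \<phi>) \<le> 0" by (intro LIMSEQ_le_const[of "\<lambda>n. 2 * e n"]) auto
    then show "\<phi> (abs_linf h) = F \<phi>" by simp
  qed
qed

section \<open>Antiperiodic translations\<close>

lemma AE_circle_iff_restrict:
  assumes N: "N \<in> sets circle_measure"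
  shows "N \<in> null_sets circle_measure \<longleftrightarrow> (AE t in lborel. 0 \<le> t \<and> t < 2 * pi \<longrightarrow> cis t \<notin> N)"
proof -
  let ?R = "restrict_space lborel {0..<2 * pi}"
  have sub: "N \<subseteq> sphere 0 1" using sets.sets_into_space[OF N] by simp
  have "{z \<in> space (restrict_space borel (sphere 0 1)). z \<notin> N} \<in> sets (restrict_space borel (sphere 0 1))"
    using sets.compl_sets[OF N] sub by (simp add: sets_circle_measure space_restrict_space set_diff_eq)
  then have "(AE z in circle_measure. z \<notin> N) \<longleftrightarrow> (AE t in ?R. cis t \<notin> N)"
    unfolding circle_measure_def by (rule AE_distr_iff[OF measurable_cis_circle])
  moreover have "(AE z in circle_measure. z \<notin> N) \<longleftrightarrow> N \<in> null_sets circle_measure"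
    using AE_iff_null_sets[OF N] by simp
  ultimately show ?thesis by (simp add: AE_restrict_space_iff)
qed

lemma AE_lborel_shift:
  fixes a :: real
  assumes "AE t in lborel. P t" shows "AE t in lborel. P (a + t)"
proof -
  obtain N where N: "N \<in> null_sets lborel" "\<And>t. t \<in> space lborel - N \<Longrightarrow> P t"
    using AE_E3[OF assms] by metis
  have "N \<in> sets borel" using N(1) by auto
  then have "Measurable.pred borel (\<lambda>t. t \<notin> N)" by measurable
  then have "AE t in lborel. a + 1 * t \<notin> N"
    using N(1) by (intro AE_borel_affine AE_not_in) auto
  then show ?thesis by eventually_elim (use N(2) in auto)
qed

lemma cis_add_2pi_int: "cis (t + of_int k * (2 * pi)) = cis t"
  by (simp add: cis_mult[symmetric]) (metis cis_multiple_2pi Ints_of_int mult.commute mult.right_neutral mult.assoc)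

lemma period_reduce:
  fixes t :: real
  obtains k :: int and r where "t = r + of_int k * (2 * pi)" "0 \<le> r" "r < 2 * pi"
proof
  let ?k = "\<lfloor>t / (2 * pi)\<rfloor>"
  show "t = (t - of_int ?k * (2 * pi)) + of_int ?k * (2 * pi)" by simp
  show "0 \<le> t - of_int ?k * (2 * pi)" "t - of_int ?k * (2 * pi) < 2 * pi"
    using floor_divide_lower[of "2 * pi" t] floor_divide_upper[of "2 * pi" t] by (auto simp: algebra_simps)
qed

text \<open>The argument is continuous off the nonnegative reals, and on this closed set it is
  0.\<close>

lemma Arg2pi_measurable: "Arg2pi \<in> borel_measurable borel"
proof -
  have "(\<lambda>z. if z \<in> \<real>\<^sub>\<ge>\<^sub>0 then 0 else Arg2pi z) \<in> borel_measurable borel"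
    by (intro borel_measurable_continuous_on_if continuous_at_imp_continuous_on continuous_on_const ballI
        continuous_at_Arg2pi borel_closed closed_nonneg_Reals_complex) auto
  moreover have "(\<lambda>z. if z \<in> \<real>\<^sub>\<ge>\<^sub>0 then 0 else Arg2pi z) = Arg2pi"
    by (auto simp: Arg2pi_eq_0 complex_nonneg_Reals_iff complex_is_Real_iff fun_eq_iff)
  ultimately show ?thesis by simp
qed

lemma measurable_circleI: "f \<in> borel_measurable borel \<Longrightarrow> f \<in> borel_measurable circle_measure"
  by (subst measurable_cong_sets[OF sets_circle_measure refl]) (rule measurable_restrict_space1)

lemma Arg2pi_cis: "0 \<le> t \<Longrightarrow> t < 2 * pi \<Longrightarrow> Arg2pi (cis t) = t"
  by (rule Arg2pi_unique[of 1]) (auto simp: cis_conv_exp)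

text \<open>This moves every almost everywhere statement to the line, where translation invariance
  is available. In one direction a null set in the base period is repeated over the countably many
  periods; in the other a null set of the line is pulled back along \<open>Arg2pi\<close>.\<close>

lemma AE_circle_iff: "(AE z in circle_measure. P z) \<longleftrightarrow> (AE t in lborel. P (cis t))"
proof
  assume "AE z in circle_measure. P z"
  then obtain N where N: "N \<in> null_sets circle_measure" "\<And>z. z \<in> space circle_measure - N \<Longrightarrow> P z"
    using AE_E3 by metis
  then have "AE t in lborel. 0 \<le> t \<and> t < 2 * pi \<longrightarrow> cis t \<notin> N" using AE_circle_iff_restrict by blast
  then have "AE t in lborel. \<forall>k::int. 0 \<le> of_int k * (2 * pi) + t \<and> of_int k * (2 * pi) + t < 2 * pi
      \<longrightarrow> cis (of_int k * (2 * pi) + t) \<notin> N"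
    unfolding AE_all_countable by (intro allI AE_lborel_shift)
  then show "AE t in lborel. P (cis t)"
  proof eventually_elim
    case (elim t)
    obtain k r where kr: "t = r + of_int k * (2 * pi)" "0 \<le> r" "r < 2 * pi" by (rule period_reduce)
    then have req: "of_int (- k) * (2 * pi) + t = r" by simp
    have "cis r \<notin> N" using elim[rule_format, of "- k"] kr(2,3) unfolding req by blast
    then have "cis t \<notin> N" unfolding kr(1) cis_add_2pi_int .
    then show ?case using N(2)[of "cis t"] by simp
  qed
next
  assume "AE t in lborel. P (cis t)"
  then obtain N where N: "N \<in> null_sets lborel" "\<And>t. t \<in> space lborel - N \<Longrightarrow> P (cis t)"
    using AE_E3 by metis
  define N' where "N' = {z \<in> space circle_measure. Arg2pi z \<in> N}"
  have "N' \<in> sets circle_measure"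
    using measurable_sets[OF measurable_circleI[OF Arg2pi_measurable], of N] N(1)
    by (simp add: N'_def vimage_def Int_def conj_commute null_sets_def)
  moreover have "AE t in lborel. t \<notin> N" using N(1) by (rule AE_not_in)
  then have "AE t in lborel. 0 \<le> t \<and> t < 2 * pi \<longrightarrow> cis t \<notin> N'"
    by eventually_elim (simp add: N'_def Arg2pi_cis)
  ultimately have "N' \<in> null_sets circle_measure" using AE_circle_iff_restrict by blast
  then have "AE z in circle_measure. z \<notin> N'" by (rule AE_not_in)
  with AE_space show "AE z in circle_measure. P z"
  proof eventually_elim
    case (elim z)
    then have "cis (Arg2pi z) = z" by (simp add: cis_conv_exp complex_norm_eq_1_exp)
    with elim N(2)[of "Arg2pi z"] show ?case by (simp add: N'_def)
  qed
qed

section \<open>Rotations of the algebra\<close>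

lemma AE_circle_rotate: "(AE z in circle_measure. P z) \<Longrightarrow> AE z in circle_measure. P (cis s * z)"
  using AE_lborel_shift[of "\<lambda>t. P (cis t)" s] by (simp add: AE_circle_iff cis_mult)

lemma circle_rotate_measurable: "(\<lambda>z. cis s * z) \<in> circle_measure \<rightarrow>\<^sub>M circle_measure"
proof -
  have "(\<lambda>z. cis s * z) \<in> restrict_space borel (sphere 0 1) \<rightarrow>\<^sub>M restrict_space borel (sphere 0 1)"
    by (intro measurable_restrict_space3 borel_measurable_times) (auto simp: norm_mult)
  then show ?thesis by (simp add: measurable_cong_sets[OF sets_circle_measure sets_circle_measure])
qed

lemma ess_bounded_rotate: "ess_bounded f \<Longrightarrow> ess_bounded (\<lambda>z. f (cis s * z))"
  unfolding ess_bounded_def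
  using measurable_compose[OF circle_rotate_measurable] AE_circle_rotate by blast

lift_definition linf_rot :: "real \<Rightarrow> linf \<Rightarrow> linf" is "\<lambda>s f z. f (cis s * z)"
  unfolding linf_rel_def using ess_bounded_rotate AE_circle_rotate by blast

lemma rep_linf_rot: "AE z in circle_measure. rep_linf (linf_rot s f) z = rep_linf f (cis s * z)"
  unfolding linf_rot_def map_fun_def o_def id_def
  by (rule rep_abs_linf) (intro ess_bounded_rotate ess_bounded_rep_linf)

text \<open>The sign of the antiperiodic extension: a function of period \<open>2 * pi\<close> times
  this factor changes sign after each full turn and is unchanged on the base period.\<close>

definition period_sign :: "real \<Rightarrow> complex" where
  "period_sign t = (if even \<lfloor>t / (2 * pi)\<rfloor> then 1 else - 1)"

lemma period_sign_square: "period_sign t * period_sign t = 1"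
  by (simp add: period_sign_def)

lemma period_sign_add: "period_sign (t + of_int k * (2 * pi)) = (if even k then 1 else - 1) * period_sign t"
proof -
  have "(t + of_int k * (2 * pi)) / (2 * pi) = t / (2 * pi) + of_int k" by (simp add: add_divide_distrib)
  then show ?thesis by (simp add: period_sign_def)
qed

lemma period_sign_base: "0 \<le> t \<Longrightarrow> t < 2 * pi \<Longrightarrow> period_sign t = 1"
proof -
  assume "0 \<le> t" "t < 2 * pi"
  then have "\<lfloor>t / (2 * pi)\<rfloor> = 0" by (simp add: floor_eq_iff)
  then show ?thesis by (simp add: period_sign_def)
qed

lemma period_sign_measurable [measurable]: "period_sign \<in> borel_measurable borel"
  unfolding period_sign_def by measurable

text \<open>The sign picked up by the antiperiodic extension when the point of the base period over
  \<open>z\<close> moves by \<open>s\<close>.\<close>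

definition sign_weight :: "real \<Rightarrow> complex \<Rightarrow> complex" where
  "sign_weight s z = period_sign (Arg2pi z + s)"

text \<open>The product on the right does not change when \<open>t\<close> moves by a full turn,
  since both factors flip. Hence the formula holds for every real \<open>t\<close> once it holds on
  the base period.\<close>

lemma sign_weight_cis: "sign_weight s (cis t) = period_sign t * period_sign (t + s)"
proof -
  obtain k r where kr: "t = r + of_int k * (2 * pi)" "0 \<le> r" "r < 2 * pi" by (rule period_reduce)
  have "cis t = cis r" unfolding kr(1) cis_add_2pi_int ..
  then have "sign_weight s (cis t) = period_sign (r + s)" using kr by (simp add: sign_weight_def Arg2pi_cis)
  moreover have "period_sign (t + s) = (if even k then 1 else - 1) * period_sign (r + s)"
    using period_sign_add[of "r + s" k] by (simp add: kr(1) add_ac)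
  moreover have "period_sign t = (if even k then 1 else - 1)"
    using period_sign_add[of r k] kr by (simp add: period_sign_base)
  ultimately show ?thesis by simp
qed

lemma ess_bounded_sign_weight: "ess_bounded (sign_weight s)"
  unfolding ess_bounded_def
proof (intro conjI exI[of _ 1] AE_I2)
  have "(\<lambda>z. period_sign (Arg2pi z + s)) \<in> borel_measurable borel" using Arg2pi_measurable by measurable
  then show "sign_weight s \<in> borel_measurable circle_measure"
    unfolding sign_weight_def by (rule measurable_circleI)
qed (simp add: sign_weight_def period_sign_def)

definition linf_sign :: "real \<Rightarrow> linf" where
  "linf_sign s = abs_linf (sign_weight s)"

lemma rep_linf_sign: "AE z in circle_measure. rep_linf (linf_sign s) z = sign_weight s z"
  unfolding linf_sign_def by (rule rep_abs_linf[OF ess_bounded_sign_weight])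

lemma linf_sign_square: "linf_sign s * linf_sign s = 1"
  by (rule linf_eqI, use rep_linf_mult[of "linf_sign s" "linf_sign s"] rep_linf_one rep_linf_sign[of s] in eventually_elim)
    (simp add: sign_weight_def period_sign_square)

lemma linf_rot_add: "linf_rot s (f + g) = linf_rot s f + linf_rot s g"
  by (rule linf_eqI, use rep_linf_rot[of s "f + g"] AE_circle_rotate[OF rep_linf_add[of f g], of s]
      rep_linf_rot[of s f] rep_linf_rot[of s g] rep_linf_add[of "linf_rot s f" "linf_rot s g"] in eventually_elim) simp

lemma linf_rot_mult: "linf_rot s (f * g) = linf_rot s f * linf_rot s g"
  by (rule linf_eqI, use rep_linf_rot[of s "f * g"] AE_circle_rotate[OF rep_linf_mult[of f g], of s]
      rep_linf_rot[of s f] rep_linf_rot[of s g] rep_linf_mult[of "linf_rot s f" "linf_rot s g"] in eventually_elim) simp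

lemma linf_rot_scale: "linf_rot s (linf_scale c f) = linf_scale c (linf_rot s f)"
  by (rule linf_eqI, use rep_linf_rot[of s "linf_scale c f"] AE_circle_rotate[OF rep_linf_scale[of c f], of s]
      rep_linf_rot[of s f] rep_linf_scale[of c "linf_rot s f"] in eventually_elim) simp

lemma linf_rot_one: "linf_rot s 1 = 1"
  by (rule linf_eqI, use rep_linf_rot[of s 1] AE_circle_rotate[OF rep_linf_one, of s] rep_linf_one in eventually_elim) simp

lemma linf_rot_0: "linf_rot 0 f = f"
  by (rule linf_eqI, use rep_linf_rot[of 0 f] in eventually_elim) simp

lemma linf_rot_rot: "linf_rot s (linf_rot r f) = linf_rot (s + r) f"
  by (rule linf_eqI, use rep_linf_rot[of s "linf_rot r f"] AE_circle_rotate[OF rep_linf_rot[of r f], of s]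
      rep_linf_rot[of "s + r" f] in eventually_elim) (simp add: cis_mult mult.assoc[symmetric] add.commute)

text \<open>With both weights written as products of period signs, the sign at the intermediate
  point \<open>t + s\<close> occurs twice and cancels. This identity turns the antiperiodic shifts
  into a one-parameter group.\<close>

lemma linf_sign_cocycle: "linf_sign s * linf_rot s (linf_sign r) = linf_sign (s + r)"
proof (rule linf_eqI)
  have cocycle: "AE z in circle_measure. sign_weight s z * sign_weight r (cis s * z) = sign_weight (s + r) z"
    unfolding AE_circle_iff
    by (rule AE_I2) (simp add: cis_mult sign_weight_cis add_ac, use period_sign_square[of "t + s" for t] in \<open>simp add: mult_ac add_ac\<close>)
  show "AE z in circle_measure. rep_linf (linf_sign s * linf_rot s (linf_sign r)) z = rep_linf (linf_sign (s + r)) z"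
    using rep_linf_mult[of "linf_sign s" "linf_rot s (linf_sign r)"] rep_linf_sign[of s]
      rep_linf_rot[of s "linf_sign r"] AE_circle_rotate[OF rep_linf_sign[of r], of s] rep_linf_sign[of "s + r"] cocycle
    by eventually_elim simp
qed

lemma linf_sign_0: "linf_sign 0 = 1"
  by (rule linf_eqI, use rep_linf_one rep_linf_sign[of 0] in eventually_elim)
    (simp add: sign_weight_def period_sign_base Arg2pi_ge_0 Arg2pi_lt_2pi)

text \<open>Translation of the antiperiodic extension by \<open>s\<close>, read off again on the
  base period.\<close>

definition antiperiodic_shift :: "real \<Rightarrow> linf \<Rightarrow> linf" where
  "antiperiodic_shift s g = linf_sign s * linf_rot s g"

lemma antiperiodic_shift_shift: "antiperiodic_shift s (antiperiodic_shift r g) = antiperiodic_shift (s + r) g"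
  by (simp add: antiperiodic_shift_def linf_rot_mult linf_rot_rot mult.assoc[symmetric] linf_sign_cocycle)

lemma antiperiodic_shift_0: "antiperiodic_shift 0 g = g"
  by (simp add: antiperiodic_shift_def linf_sign_0 linf_rot_0)

text \<open>The bracket is the antiperiodic extension of \<open>g\<close> at \<open>t + s\<close>;
  the outer sign undoes the extension at \<open>t\<close>.\<close>

lemma rep_antiperiodic_shift:
  "AE t in lborel. rep_linf (antiperiodic_shift s g) (cis t) = period_sign t * (period_sign (t + s) * rep_linf g (cis (t + s)))"
proof -
  have "AE z in circle_measure. rep_linf (antiperiodic_shift s g) z = sign_weight s z * rep_linf g (cis s * z)"
    unfolding antiperiodic_shift_def
    using rep_linf_mult[of "linf_sign s" "linf_rot s g"] rep_linf_sign[of s] rep_linf_rot[of s g] by eventually_elim simp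
  then show ?thesis unfolding AE_circle_iff by eventually_elim (simp add: sign_weight_cis cis_mult add.commute)
qed

section \<open>Integrals of translates\<close>

lemma cis_measurable_circle: "cis \<in> borel \<rightarrow>\<^sub>M circle_measure"
proof -
  have "cis \<in> borel \<rightarrow>\<^sub>M restrict_space borel (sphere 0 1)"
    by (intro measurable_restrict_space2 borel_measurable_continuous_onI continuous_intros) auto
  then show ?thesis by (simp add: measurable_cong_sets[OF refl sets_circle_measure])
qed

lemma rep_linf_cis_measurable [measurable]: "(\<lambda>t. rep_linf g (cis t)) \<in> borel_measurable borel"
  by (rule measurable_compose[OF cis_measurable_circle rep_linf_measurable])

lemma lebesgue_Ico_finite: "emeasure lborel {a..<b :: real} < \<infinity>"
  by (cases "a \<le> b") auto

lemma rep_linf_cis_set_integrable: "set_integrable lborel {a..<b} (\<lambda>t. rep_linf g (cis t))"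
proof -
  obtain B where "AE z in circle_measure. norm (rep_linf g z) \<le> B" by (rule rep_linf_bound)
  then have "AE t in lborel. norm (rep_linf g (cis t)) \<le> B" unfolding AE_circle_iff .
  then show ?thesis
    unfolding set_integrable_def
    by (intro integrableI_bounded_set_indicator[where B = B]) (use lebesgue_Ico_finite in \<open>auto elim: eventually_mono\<close>)
qed

definition linf_integral :: "linf \<Rightarrow> complex" where
  "linf_integral g = (LBINT t:{0..<2 * pi}. rep_linf g (cis t))"

lemma linf_integral_cong_AE:
  assumes "f \<in> borel_measurable borel" "AE t in lborel. rep_linf g (cis t) = f t"
  shows "linf_integral g = (LBINT t:{0..<2 * pi}. f t)"
  unfolding linf_integral_def
  by (rule set_lebesgue_integral_cong_AE) (use assms in \<open>auto elim: eventually_mono\<close>)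

lemma linf_integral_add: "linf_integral (f + g) = linf_integral f + linf_integral g"
proof -
  have "linf_integral (f + g) = (LBINT t:{0..<2 * pi}. rep_linf f (cis t) + rep_linf g (cis t))"
    using rep_linf_add[of f g] unfolding AE_circle_iff by (intro linf_integral_cong_AE) simp_all
  then show ?thesis
    by (simp add: linf_integral_def set_integral_add(2) rep_linf_cis_set_integrable)
qed

lemma linf_integral_scale: "linf_integral (linf_scale c f) = c * linf_integral f"
proof -
  have "linf_integral (linf_scale c f) = (LBINT t:{0..<2 * pi}. c * rep_linf f (cis t))"
    using rep_linf_scale[of c f] unfolding AE_circle_iff by (intro linf_integral_cong_AE) simp_all
  then show ?thesis by (simp add: linf_integral_def)
qed

lemma set_integral_interval_bound:
  fixes f :: "real \<Rightarrow> complex"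
  assumes "AE t in lborel. norm (f t) \<le> B" "a \<le> b" "set_integrable lborel {a..<b} f"
  shows "norm (LBINT t:{a..<b}. f t) \<le> B * (b - a)"
proof -
  have "norm (LBINT t:{a..<b}. f t) \<le> (LBINT t:{a..<b}. norm (f t))"
    by (rule set_integral_norm_bound[OF assms(3)])
  also have "\<dots> \<le> (LBINT t:{a..<b}. B)"
  proof (rule set_integral_mono_AE[OF set_integrable_norm[OF assms(3)]])
    show "set_integrable lborel {a..<b} (\<lambda>t. B)"
      unfolding set_integrable_def
      by (intro integrableI_bounded_set_indicator[where B = "\<bar>B\<bar>"]) (use lebesgue_Ico_finite in auto)
  qed (use assms(1) in \<open>auto elim: eventually_mono\<close>)
  also have "\<dots> = B * (b - a)" using assms(2) by (simp add: set_lebesgue_integral_def measure_lborel_Ico)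
  finally show ?thesis .
qed

lemma linf_integral_bound:
  assumes "AE z in circle_measure. norm (rep_linf g z) \<le> B"
  shows "norm (linf_integral g) \<le> B * (2 * pi)"
  using set_integral_interval_bound[of "\<lambda>t. rep_linf g (cis t)" B 0 "2 * pi"] assms rep_linf_cis_set_integrable
  by (simp add: linf_integral_def AE_circle_iff)

lemma linf_integral_real:
  assumes "AE z in circle_measure. rep_linf g z \<in> \<real>"
  shows "linf_integral g \<in> \<real>"
proof -
  have "AE t in lborel. rep_linf g (cis t) = of_real (Re (rep_linf g (cis t)))"
    using assms unfolding AE_circle_iff by eventually_elim simp
  then have "linf_integral g = (LBINT t:{0..<2 * pi}. of_real (Re (rep_linf g (cis t))))"
    by (intro linf_integral_cong_AE) simp_all
  also have "\<dots> = of_real (LBINT t:{0..<2 * pi}. Re (rep_linf g (cis t)))"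
    by (rule set_integral_complex_of_real)
  finally show ?thesis by simp
qed

lemma linf_integral_antiperiodic_shift_period:
  "linf_integral (antiperiodic_shift (s + of_int k * (2 * pi)) g)
    = (if even k then 1 else - 1) * linf_integral (antiperiodic_shift s g)"
proof -
  have *: "linf_integral (antiperiodic_shift r g)
      = (LBINT t:{0..<2 * pi}. period_sign t * (period_sign (t + r) * rep_linf g (cis (t + r))))" for r
  proof (rule linf_integral_cong_AE)
    show "(\<lambda>t. period_sign t * (period_sign (t + r) * rep_linf g (cis (t + r)))) \<in> borel_measurable borel"
      using measurable_compose[of "\<lambda>t. t + r" borel borel, OF _ rep_linf_cis_measurable] by measurable
  qed (rule rep_antiperiodic_shift)
  define c :: complex where "c = (if even k then 1 else - 1)"
  have "period_sign t * (period_sign (t + (s + of_int k * (2 * pi))) * rep_linf g (cis (t + (s + of_int k * (2 * pi)))))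
      = c * (period_sign t * (period_sign (t + s) * rep_linf g (cis (t + s))))" for t
    using period_sign_add[of "t + s" k] cis_add_2pi_int[of "t + s" k] by (simp add: add.assoc c_def)
  then show ?thesis unfolding * c_def[symmetric] by (simp only: set_integral_mult_right)
qed

text \<open>The window \<open>{0..<2 * pi}\<close> moves to \<open>{s..<2 * pi + s}\<close>. It
  loses the integral over \<open>{0..<s}\<close>, and the piece gained beyond \<open>2 * pi\<close>
  is the negative of the same integral, so that integral is subtracted twice.\<close>

lemma linf_integral_antiperiodic_shift:
  assumes "0 \<le> s" "s \<le> 2 * pi"
  shows "linf_integral (antiperiodic_shift s g) = linf_integral g - 2 * (LBINT t:{0..<s}. rep_linf g (cis t))"
proof -
  let ?G = "\<lambda>t. rep_linf g (cis t)"
  \<comment> \<open>\<open>K\<close> is the antiperiodic extension of \<open>g\<close> to the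
    line.\<close>
  define K where "K t = period_sign t * ?G t" for t
  have K_meas [measurable]: "K \<in> borel_measurable borel" unfolding K_def by measurable
  obtain B where "AE z in circle_measure. norm (rep_linf g z) \<le> B" by (rule rep_linf_bound)
  then have "AE t in lborel. norm (K t) \<le> B"
    unfolding AE_circle_iff by eventually_elim (simp add: K_def period_sign_def)
  then have K_int: "set_integrable lborel {a..<b} K" for a b
    unfolding set_integrable_def
    by (intro integrableI_bounded_set_indicator[where B = B]) (use lebesgue_Ico_finite in \<open>auto elim: eventually_mono\<close>)
  have shift: "(LBINT t:{a..<b}. K (t + r)) = (LBINT t:{a + r..<b + r}. K t)" for a b r
  proof -
    have "(LBINT t:{a + r..<b + r}. K t) = (LBINT t. indicator {a + r..<b + r} (r + 1 * t) *\<^sub>R K (r + 1 * t))"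
      unfolding set_lebesgue_integral_def by (subst lborel_integral_real_affine[of 1 _ r]) auto
    also have "\<dots> = (LBINT t:{a..<b}. K (t + r))"
      unfolding set_lebesgue_integral_def by (intro Bochner_Integration.integral_cong) (auto simp: indicator_def add.commute)
    finally show ?thesis ..
  qed
  have split: "(LBINT t:{a..<c}. K t) = (LBINT t:{a..<b}. K t) + (LBINT t:{b..<c}. K t)" if "a \<le> b" "b \<le> c" for a b c
    using set_integral_Un[OF _ K_int K_int, of a b b c] that by (simp add: ivl_disj_un)
  have "linf_integral (antiperiodic_shift s g) = (LBINT t:{0..<2 * pi}. period_sign t * K (t + s))"
    using rep_antiperiodic_shift[of s g] by (intro linf_integral_cong_AE) (simp_all add: K_def)
  also have "\<dots> = (LBINT t:{0..<2 * pi}. K (t + s))"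
    by (rule set_lebesgue_integral_cong) (auto simp: period_sign_base)
  also have "\<dots> = (LBINT t:{s..<2 * pi}. K t) + (LBINT t:{2 * pi..<2 * pi + s}. K t)"
    using shift[of 0 "2 * pi" s] split[of s "2 * pi" "2 * pi + s"] assms by simp
  also have "(LBINT t:{2 * pi..<2 * pi + s}. K t) = (LBINT t:{0..<s}. K (t + 2 * pi))"
    using shift[of 0 s "2 * pi"] by (simp add: add.commute)
  also have "\<dots> = - (LBINT t:{0..<s}. K t)"
  proof -
    have "K (t + 2 * pi) = - 1 * K t" for t
      using period_sign_add[of t 1] cis_add_2pi_int[of t 1] by (simp add: K_def)
    then show ?thesis by (simp only: set_integral_mult_right) simp
  qed
  also have "(LBINT t:{s..<2 * pi}. K t) = (LBINT t:{0..<2 * pi}. K t) - (LBINT t:{0..<s}. K t)"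
    using split[of 0 s "2 * pi"] assms by simp
  also have "(LBINT t:{0..<2 * pi}. K t) = linf_integral g"
    unfolding linf_integral_def by (rule set_lebesgue_integral_cong) (auto simp: K_def period_sign_base)
  also have "(LBINT t:{0..<s}. K t) = (LBINT t:{0..<s}. ?G t)"
    by (rule set_lebesgue_integral_cong) (use assms in \<open>auto simp: K_def period_sign_base\<close>)
  finally show ?thesis by simp
qed

text \<open>By the preceding formula two values differ, up to sign, by twice the integral of the
  bounded function \<open>g\<close> between the two angles.\<close>

lemma linf_integral_antiperiodic_shift_lipschitz:
  obtains B where "B \<ge> 0" "\<And>s r. \<lbrakk>0 \<le> s; s \<le> 2 * pi; 0 \<le> r; r \<le> 2 * pi\<rbrakk> \<Longrightarrow>
    norm (linf_integral (antiperiodic_shift s g) - linf_integral (antiperiodic_shift r g)) \<le> B * \<bar>s - r\<bar>"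
proof -
  let ?G = "\<lambda>t. rep_linf g (cis t)"
  obtain B where "AE z in circle_measure. norm (rep_linf g z) \<le> B" by (rule rep_linf_bound)
  then have B: "AE t in lborel. norm (?G t) \<le> max B 0"
    unfolding AE_circle_iff by eventually_elim simp
  have *: "norm (linf_integral (antiperiodic_shift s g) - linf_integral (antiperiodic_shift r g)) \<le> 2 * max B 0 * \<bar>s - r\<bar>"
    if "0 \<le> s" "s \<le> r" "r \<le> 2 * pi" for s r
  proof -
    have "(LBINT t:{0..<r}. ?G t) = (LBINT t:{0..<s}. ?G t) + (LBINT t:{s..<r}. ?G t)"
      using set_integral_Un[OF _ rep_linf_cis_set_integrable rep_linf_cis_set_integrable, of 0 s s r g] that
      by (simp add: ivl_disj_un)
    then have "linf_integral (antiperiodic_shift s g) - linf_integral (antiperiodic_shift r g) = 2 * (LBINT t:{s..<r}. ?G t)"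
      using that by (simp add: linf_integral_antiperiodic_shift)
    moreover have "norm (LBINT t:{s..<r}. ?G t) \<le> max B 0 * (r - s)"
      using set_integral_interval_bound[OF B] that rep_linf_cis_set_integrable by blast
    ultimately show ?thesis using that by (simp add: norm_mult)
  qed
  show ?thesis
  proof
    show "2 * max B 0 \<ge> 0" by simp
    fix s r :: real assume "0 \<le> s" "s \<le> 2 * pi" "0 \<le> r" "r \<le> 2 * pi"
    then show "norm (linf_integral (antiperiodic_shift s g) - linf_integral (antiperiodic_shift r g)) \<le> 2 * max B 0 * \<bar>s - r\<bar>"
      using *[of s r] *[of r s] by (cases "s \<le> r") (simp_all add: norm_minus_commute abs_minus_commute)
  qed
qed

text \<open>Dynkin's argument: the half-lines generate the Borel sets and are closed under
  intersection, while the sets with integral 0 are closed under complements and countable disjoint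
  unions. A function whose integral over every Borel set is 0 vanishes almost everywhere.\<close>

lemma AE_zero_if_initial_integrals_zero:
  fixes f :: "real \<Rightarrow> complex"
  assumes f: "integrable lborel f" and 0: "\<And>a. (LBINT t:{..<a}. f t) = 0"
  shows "AE t in lborel. f t = 0"
proof (rule sigma_finite_measure.density_zero[OF sigma_finite_lborel f])
  have int: "set_integrable lborel A f" if "A \<in> sets borel" for A
    using that f by (simp add: set_integrable_def integrable_mult_indicator)
  \<comment> \<open>Complements require the integral over the whole line, obtained by exhausting it
    with half-lines.\<close>
  have total: "(LBINT t. f t) = 0"
  proof -
    have "(\<lambda>n. LBINT t:{..<real n}. f t) \<longlonglongrightarrow> (LBINT t:(\<Union>n. {..<real n}). f t)"
      by (rule set_integral_cont_up) (auto simp: incseq_def int)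
    moreover have "(\<Union>n. {..<real n}) = UNIV" using reals_Archimedean2 by auto
    ultimately show ?thesis using 0 by (simp add: set_lebesgue_integral_def LIMSEQ_const_iff)
  qed
  fix A assume "A \<in> sets (lborel :: real measure)"
  then have A: "A \<in> sigma_sets UNIV (range lessThan)" by (simp add: borel_Iio)
  have "{..<a} \<inter> {..<b} = {..<min a b}" for a b :: real by auto
  then have stable: "Int_stable (range (lessThan :: real \<Rightarrow> real set))"
    by (auto simp: Int_stable_def)
  have sub: "range (lessThan :: real \<Rightarrow> real set) \<subseteq> Pow UNIV" by simp
  from stable sub A show "(LBINT t:A. f t) = 0"
  proof (induct A rule: sigma_sets_induct_disjoint)
    case (compl A)
    then have A: "A \<in> sets borel" by (simp add: borel_Iio)
    have "(LBINT t:A \<union> (UNIV - A). f t) = (LBINT t:A. f t) + (LBINT t:UNIV - A. f t)"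
      by (rule set_integral_Un) (use A int in auto)
    moreover have "A \<union> (UNIV - A) = UNIV" by auto
    ultimately show ?case using compl total by (simp add: set_lebesgue_integral_def)
  next
    case (union A)
    then have A: "\<And>i. A i \<in> sets borel" by (auto simp: borel_Iio)
    have "(LBINT t:(\<Union>i. A i). f t) = (\<Sum>i. (LBINT t:A i. f t))"
      by (rule lebesgue_integral_countable_add)
        (use A union(1) int in \<open>auto simp: disjoint_family_on_def sets.countable_UN\<close>)
    then show ?case using union by simp
  qed (use 0 in \<open>auto simp: set_lebesgue_integral_def\<close>)
qed

text \<open>Continuity extends the hypothesis to \<open>s = 0\<close>, where it says that the full
  integral of \<open>g\<close> is 0. The formula for translates then makes all initial integrals of
  \<open>g\<close> vanish.\<close>

lemma linf_eq_zero_if_shift_integrals_zero: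
  assumes "\<And>s. 0 < s \<Longrightarrow> s < 2 * pi \<Longrightarrow> linf_integral (antiperiodic_shift s g) = 0"
  shows "g = 0"
proof -
  let ?G = "\<lambda>t. rep_linf g (cis t)"
  define \<Phi> where "\<Phi> s = linf_integral (antiperiodic_shift s g)" for s
  obtain B where B: "B \<ge> 0" "\<And>s r. \<lbrakk>0 \<le> s; s \<le> 2 * pi; 0 \<le> r; r \<le> 2 * pi\<rbrakk> \<Longrightarrow> norm (\<Phi> s - \<Phi> r) \<le> B * \<bar>s - r\<bar>"
    unfolding \<Phi>_def using linf_integral_antiperiodic_shift_lipschitz[of g] by metis
  have "norm (\<Phi> 0) \<le> e" if "e > 0" for e
  proof -
    \<comment> \<open>Small enough for \<open>B * s \<le> e\<close> and inside the open period; the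
      summand 1 keeps the denominator positive when \<open>B = 0\<close>.\<close>
    define s where "s = min pi (e / (B + 1))"
    have "s \<le> pi" "s \<le> e / (B + 1)" "0 < s" using B(1) that by (auto simp: s_def)
    then have s: "0 < s" "s < 2 * pi" "s \<le> e / (B + 1)" using pi_gt_zero by linarith+
    have "norm (\<Phi> 0) \<le> B * s" using B(2)[of 0 s] s assms[of s] by (simp add: \<Phi>_def)
    also have "\<dots> \<le> (B + 1) * s" using s by simp
    also have "\<dots> \<le> e" using s B(1) by (simp add: field_simps)
    finally show ?thesis .
  qed
  then have "\<Phi> 0 = 0" using field_le_epsilon[of "norm (\<Phi> 0)" 0] by simp
  then have I0: "linf_integral g = 0" by (simp add: \<Phi>_def antiperiodic_shift_0)
  have init: "(LBINT t:{0..<s}. ?G t) = 0" if "0 \<le> s" "s \<le> 2 * pi" for s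
  proof -
    consider "s = 0" | "s = 2 * pi" | "0 < s" "s < 2 * pi" using \<open>0 \<le> s\<close> \<open>s \<le> 2 * pi\<close> by linarith
    then show ?thesis
    proof cases
      case 3
      then show ?thesis using linf_integral_antiperiodic_shift[of s g] assms[of s] I0 by simp
    qed (use I0 in \<open>auto simp: linf_integral_def set_lebesgue_integral_def\<close>)
  qed
  have "AE t in lborel. indicator {0..<2 * pi} t *\<^sub>R ?G t = 0"
  proof (rule AE_zero_if_initial_integrals_zero)
    show "integrable lborel (\<lambda>t. indicator {0..<2 * pi} t *\<^sub>R ?G t)"
      using rep_linf_cis_set_integrable[of 0 "2 * pi" g] by (simp add: set_integrable_def)
    fix a :: real
    \<comment> \<open>The upper limit \<open>a\<close> is clamped to the base period, outside of
      which the integrand is 0.\<close>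
    have "(LBINT t:{..<a}. indicator {0..<2 * pi} t *\<^sub>R ?G t) = (LBINT t:{0..<min (2 * pi) (max 0 a)}. ?G t)"
      unfolding set_lebesgue_integral_def
      by (intro Bochner_Integration.integral_cong) (auto simp: indicator_def)
    also have "\<dots> = 0" by (intro init) auto
    finally show "(LBINT t:{..<a}. indicator {0..<2 * pi} t *\<^sub>R ?G t) = 0" .
  qed
  then have G: "AE t in lborel. 0 \<le> t \<and> t < 2 * pi \<longrightarrow> ?G t = 0"
    by eventually_elim (auto simp: indicator_def split: if_splits)
  define N where "N = {z \<in> space circle_measure. rep_linf g z \<noteq> 0}"
  have N: "N \<in> sets circle_measure" unfolding N_def by measurable
  have "AE t in lborel. 0 \<le> t \<and> t < 2 * pi \<longrightarrow> cis t \<notin> N" using G by eventually_elim (simp add: N_def)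
  then have "N \<in> null_sets circle_measure" using AE_circle_iff_restrict[OF N] by simp
  then have "AE z in circle_measure. z \<notin> N" by (rule AE_not_in)
  then have "AE z in circle_measure. rep_linf g z = rep_linf 0 z"
    using AE_space rep_linf_zero by eventually_elim (auto simp: N_def)
  then show ?thesis by (rule linf_eqI)
qed

section \<open>Shifts from weighted composition operators\<close>

lemma continuous_map_disjoint_sum:
  "continuous_map (disjoint_sum X Y) Z f \<longleftrightarrow> continuous_map X Z (f \<circ> Inl) \<and> continuous_map Y Z (f \<circ> Inr)"
proof -
  have "Inl -` {x \<in> topspace (disjoint_sum X Y). f x \<in> U} = {x \<in> topspace X. f (Inl x) \<in> U}"
    "Inr -` {x \<in> topspace (disjoint_sum X Y). f x \<in> U} = {x \<in> topspace Y. f (Inr x) \<in> U}" for U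
    by (auto simp: topspace_disjoint_sum)
  then show ?thesis
    by (auto simp: continuous_map_def openin_disjoint_sum topspace_disjoint_sum Pi_iff)
qed

text \<open>Points of \<open>N\<close> are isolated, and compact subsets of a discrete space are
  finite. So only the point at infinity matters, where being open means omitting finitely many
  points, that is, finitely many indices of the enumeration.\<close>

lemma continuous_map_Alexandroff_discrete:
  fixes h :: "'n option \<Rightarrow> 'k::topological_space"
  assumes e: "bij_betw e (UNIV :: nat set) N"
  shows "continuous_map (Alexandroff_compactification (discrete_topology N)) euclidean h
    \<longleftrightarrow> (\<lambda>k. h (Some (e k))) \<longlonglongrightarrow> h None"
proof -
  let ?A = "Alexandroff_compactification (discrete_topology N)"
  have openA: "openin ?A {x \<in> topspace ?A. h x \<in> U} \<longleftrightarrow> (h None \<in> U \<longrightarrow> (\<forall>\<^sub>F k in sequentially. h (Some (e k)) \<in> U))" for U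
  proof -
    define C where "C = {p \<in> N. h (Some p) \<notin> U}"
    have C: "C = e ` {k. h (Some (e k)) \<notin> U}" using e by (auto simp: C_def bij_betw_def)
    have "inj e" using e by (simp add: bij_betw_def)
    then have "finite C \<longleftrightarrow> finite {k. h (Some (e k)) \<notin> U}"
      unfolding C by (metis finite_image_iff inj_on_subset subset_UNIV)
    then have fin: "finite C \<longleftrightarrow> (\<forall>\<^sub>F k in sequentially. h (Some (e k)) \<in> U)"
      by (simp add: cofinite_eq_sequentially[symmetric] eventually_cofinite)
    have eq: "{x \<in> topspace ?A. h x \<in> U} = (if h None \<in> U then insert None (Some ` (N - C)) else Some ` (N - C))"
      by (auto simp: C_def)
    show ?thesis
    proof (cases "h None \<in> U")
      case True
      have "openin ?A (insert None (Some ` (N - C))) \<longleftrightarrow> finite C"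
      proof
        assume "openin ?A (insert None (Some ` (N - C)))"
        then obtain D where D: "finite D" "D \<subseteq> N" "insert None (Some ` (N - C)) = insert None (Some ` (N - D))"
          unfolding openin_Alexandroff_compactification by (auto simp: compactin_discrete_topology)
        then have "Some ` (N - C) = Some ` (N - D)" by auto
        then have "N - C = N - D" by (simp add: inj_image_eq_iff)
        with D(2) have "C \<subseteq> D" by (auto simp: C_def)
        then show "finite C" using D(1) finite_subset by blast
      next
        assume "finite C"
        then show "openin ?A (insert None (Some ` (N - C)))"
          unfolding openin_Alexandroff_compactification
          by (intro disjI2 exI[of _ C]) (auto simp: compactin_discrete_topology C_def)
      qed
      then show ?thesis using True fin eq by simp
    next
      case False
      then show ?thesis unfolding eq by simp
    qed
  qed
  show ?thesis
    unfolding continuous_map_def tendsto_def using openA by auto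
qed

lemma continuous_map_mult:
  fixes f g :: "'a \<Rightarrow> 'k::real_normed_field"
  assumes "continuous_map X euclidean f" "continuous_map X euclidean g"
  shows "continuous_map X euclidean (\<lambda>x. f x * g x)"
  using assms by (auto simp: continuous_map_atin intro: tendsto_mult)

text \<open>The bound on \<open>\<mu>\<close> is stated through arbitrary upper bounds
  \<open>B\<close> because \<open>sup_norm_T\<close> compares sets of upper bounds.\<close>

locale shift_data =
  fixes Z :: "'a topology" and N :: "'n set" and e :: "nat \<Rightarrow> 'n"
    and \<sigma> \<tau> :: "'a \<Rightarrow> 'a" and w :: "'a \<Rightarrow> 'k::real_normed_field" and \<mu> :: "('a \<Rightarrow> 'k) \<Rightarrow> 'k"
  assumes e: "bij_betw e UNIV N"
    and homeo: "homeomorphic_maps Z Z \<sigma> \<tau>"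
    and w_cont: "continuous_map Z euclidean w"
    and w_sign: "\<And>z. z \<in> topspace Z \<Longrightarrow> w z = 1 \<or> w z = - 1"
    and \<mu>_add: "\<And>F G. F \<in> cont_funs Z \<Longrightarrow> G \<in> cont_funs Z \<Longrightarrow> \<mu> (\<lambda>z. F z + G z) = \<mu> F + \<mu> G"
    and \<mu>_scale: "\<And>c F. F \<in> cont_funs Z \<Longrightarrow> \<mu> (\<lambda>z. c * F z) = c * \<mu> F"
    and \<mu>_bound: "\<And>F B. F \<in> cont_funs Z \<Longrightarrow> (\<And>z. z \<in> topspace Z \<Longrightarrow> norm (F z) \<le> B) \<Longrightarrow> norm (\<mu> F) \<le> B"
begin

text \<open>The inverse of the operator \<open>U\<close>, that is, the operator whose orbits are
  studied. The weight is its own reciprocal, so \<open>U\<close> is again a weighted composition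
  operator with weight \<open>w \<circ> \<tau>\<close>.\<close>

definition V :: "('a \<Rightarrow> 'k) \<Rightarrow> 'a \<Rightarrow> 'k" where
  "V F z = (if z \<in> topspace Z then w z * F (\<sigma> z) else 0)"

definition U :: "('a \<Rightarrow> 'k) \<Rightarrow> 'a \<Rightarrow> 'k" where
  "U F z = (if z \<in> topspace Z then w (\<tau> z) * F (\<tau> z) else 0)"

definition X :: "('a + 'n option) topology" where
  "X = disjoint_sum Z (Alexandroff_compactification (discrete_topology N))"

text \<open>A point of \<open>N\<close> is located by its index under \<open>e\<close>; index 0
  receives the value of \<open>\<mu>\<close> and every other index the value of its predecessor. The
  value 0 off \<open>N\<close> is the normalisation of \<open>cont_funs\<close>.\<close>

definition T :: "('a + 'n option \<Rightarrow> 'k) \<Rightarrow> 'a + 'n option \<Rightarrow> 'k" where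
  "T f x = (case x of
      Inl z \<Rightarrow> U (f \<circ> Inl) z
    | Inr None \<Rightarrow> f (Inr None)
    | Inr (Some p) \<Rightarrow>
        if p \<in> N then (case the_inv_into UNIV e p of 0 \<Rightarrow> \<mu> (f \<circ> Inl) | Suc k \<Rightarrow> f (Inr (Some (e k)))) else 0)"

lemma \<sigma>_in: "z \<in> topspace Z \<Longrightarrow> \<sigma> z \<in> topspace Z" and \<tau>_in: "z \<in> topspace Z \<Longrightarrow> \<tau> z \<in> topspace Z"
  and \<sigma>\<tau>: "z \<in> topspace Z \<Longrightarrow> \<sigma> (\<tau> z) = z" and \<tau>\<sigma>: "z \<in> topspace Z \<Longrightarrow> \<tau> (\<sigma> z) = z"
  using homeo by (auto simp: homeomorphic_maps_def continuous_map_def)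

lemma w_square: "z \<in> topspace Z \<Longrightarrow> w z * (w z * c) = c" and norm_w: "z \<in> topspace Z \<Longrightarrow> norm (w z) = 1"
  using w_sign[of z] by auto

lemma cont_funs_iff: "F \<in> cont_funs Z \<longleftrightarrow> continuous_map Z euclidean F \<and> (\<forall>z. z \<notin> topspace Z \<longrightarrow> F z = 0)"
  by (simp add: cont_funs_def)

lemma V_cont: "F \<in> cont_funs Z \<Longrightarrow> V F \<in> cont_funs Z"
  and U_cont: "F \<in> cont_funs Z \<Longrightarrow> U F \<in> cont_funs Z"
proof -
  assume "F \<in> cont_funs Z"
  then have F: "continuous_map Z euclidean F" by (simp add: cont_funs_iff)
  have hom: "continuous_map Z Z \<sigma>" "continuous_map Z Z \<tau>" using homeo by (auto simp: homeomorphic_maps_def)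
  have "continuous_map Z euclidean (\<lambda>z. w z * (F \<circ> \<sigma>) z)" "continuous_map Z euclidean (\<lambda>z. (w \<circ> \<tau>) z * (F \<circ> \<tau>) z)"
    by (intro continuous_map_mult w_cont continuous_map_compose[OF hom(1) F] continuous_map_compose[OF hom(2) F]
        continuous_map_compose[OF hom(2) w_cont])+
  from this[THEN continuous_map_eq] have "continuous_map Z euclidean (V F)" "continuous_map Z euclidean (U F)"
    by (simp_all add: V_def U_def)
  then show "V F \<in> cont_funs Z" "U F \<in> cont_funs Z" by (auto simp: cont_funs_iff V_def U_def)
qed

lemma VU: "F \<in> cont_funs Z \<Longrightarrow> V (U F) = F" and UV: "F \<in> cont_funs Z \<Longrightarrow> U (V F) = F"
  by (auto simp: V_def U_def cont_funs_iff fun_eq_iff \<sigma>_in \<tau>_in \<sigma>\<tau> \<tau>\<sigma> w_square)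

lemma U_linear: "U (\<lambda>z. F z + G z) = (\<lambda>z. U F z + U G z)" "U (\<lambda>z. c * F z) = (\<lambda>z. c * U F z)"
  by (auto simp: U_def fun_eq_iff algebra_simps)

lemma U_bound_iff: "(\<forall>z\<in>topspace Z. norm (U F z) \<le> B) \<longleftrightarrow> (\<forall>z\<in>topspace Z. norm (F z) \<le> B)"
proof
  assume L: "\<forall>z\<in>topspace Z. norm (U F z) \<le> B"
  show "\<forall>z\<in>topspace Z. norm (F z) \<le> B"
  proof
    fix z assume "z \<in> topspace Z"
    with L[rule_format, of "\<sigma> z"] show "norm (F z) \<le> B"
      by (simp add: U_def \<sigma>_in \<tau>\<sigma> norm_mult norm_w)
  qed
qed (auto simp: U_def norm_mult norm_w \<tau>_in)

lemma inv_e [simp]: "the_inv_into UNIV e (e k) = k" and e_in [simp]: "e k \<in> N"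
  using e by (auto simp: bij_betw_def the_inv_into_f_f)

lemma in_N: assumes "p \<in> N" obtains k where "p = e k"
  using e assms by (auto simp: bij_betw_def)

lemma mem_X_iff:
  fixes f :: "'a + 'n option \<Rightarrow> 'k"
  shows "f \<in> cont_funs X \<longleftrightarrow> f \<circ> Inl \<in> cont_funs Z \<and> (\<forall>p. p \<notin> N \<longrightarrow> f (Inr (Some p)) = 0)
      \<and> (\<lambda>k. f (Inr (Some (e k)))) \<longlonglongrightarrow> f (Inr None)"
proof -
  have off: "(\<forall>x. x \<notin> topspace X \<longrightarrow> f x = 0) \<longleftrightarrow>
      (\<forall>z. z \<notin> topspace Z \<longrightarrow> f (Inl z) = 0) \<and> (\<forall>p. p \<notin> N \<longrightarrow> f (Inr (Some p)) = 0)"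
    (is "?L \<longleftrightarrow> ?R")
  proof
    show ?L if ?R
    proof (intro allI impI)
      fix x assume x: "x \<notin> topspace X"
      show "f x = 0"
      proof (cases x)
        case (Inr y)
        with x that show ?thesis by (cases y) (auto simp: X_def topspace_disjoint_sum image_iff)
      qed (use x that in \<open>auto simp: X_def topspace_disjoint_sum\<close>)
    qed
  qed (auto simp: X_def topspace_disjoint_sum)
  have cont: "continuous_map X euclidean f \<longleftrightarrow> continuous_map Z euclidean (f \<circ> Inl)
      \<and> (\<lambda>k. f (Inr (Some (e k)))) \<longlonglongrightarrow> f (Inr None)"
    by (simp add: X_def continuous_map_disjoint_sum continuous_map_Alexandroff_discrete[OF e])
  show ?thesis
    unfolding cont_funs_def mem_Collect_eq off cont by auto
qed

lemma T_simps [simp]: "T f \<circ> Inl = U (f \<circ> Inl)" "T f (Inr None) = f (Inr None)"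
  "T f (Inr (Some (e 0))) = \<mu> (f \<circ> Inl)" "T f (Inr (Some (e (Suc k)))) = f (Inr (Some (e k)))"
  "p \<notin> N \<Longrightarrow> T f (Inr (Some p)) = 0"
  by (auto simp: T_def)

lemma eqI:
  fixes f g :: "'a + 'n option \<Rightarrow> 'k"
  assumes "f \<in> cont_funs X" "g \<in> cont_funs X" "f \<circ> Inl = g \<circ> Inl" "f (Inr None) = g (Inr None)"
    "\<And>k. f (Inr (Some (e k))) = g (Inr (Some (e k)))"
  shows "f = g"
proof
  fix x :: "'a + 'n option"
  consider z where "x = Inl z" | "x = Inr None" | k where "x = Inr (Some (e k))" | p where "x = Inr (Some p)" "p \<notin> N"
    by (metis in_N not_Some_eq sum.exhaust)
  then show "f x = g x"
  proof cases
    case 1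
    then show ?thesis using fun_cong[OF assms(3)] by simp
  qed (use assms in \<open>auto simp: mem_X_iff\<close>)
qed

lemma T_mem: "f \<in> cont_funs X \<Longrightarrow> T f \<in> cont_funs X"
  unfolding mem_X_iff by (auto intro: U_cont LIMSEQ_imp_Suc)

text \<open>A preimage is recovered by applying \<open>V\<close> on \<open>Z\<close> and moving the
  sequence one place to the left. Only the value at the first isolated point gets lost, and it must
  agree with \<open>\<mu>\<close> of the recovered part on \<open>Z\<close>.\<close>

lemma range_T_iff: "g \<in> T ` cont_funs X \<longleftrightarrow> g \<in> cont_funs X \<and> g (Inr (Some (e 0))) = \<mu> (V (g \<circ> Inl))"
proof
  assume "g \<in> T ` cont_funs X"
  then show "g \<in> cont_funs X \<and> g (Inr (Some (e 0))) = \<mu> (V (g \<circ> Inl))"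
    using T_mem by (auto simp: VU mem_X_iff)
next
  assume g: "g \<in> cont_funs X \<and> g (Inr (Some (e 0))) = \<mu> (V (g \<circ> Inl))"
  define f where "f x = (case x of Inl z \<Rightarrow> V (g \<circ> Inl) z | Inr None \<Rightarrow> g (Inr None)
      | Inr (Some p) \<Rightarrow> if p \<in> N then g (Inr (Some (e (Suc (the_inv_into UNIV e p))))) else 0)" for x
  have f: "f \<circ> Inl = V (g \<circ> Inl)" "f (Inr None) = g (Inr None)" "f (Inr (Some (e k))) = g (Inr (Some (e (Suc k))))"
    "p \<notin> N \<Longrightarrow> f (Inr (Some p)) = 0" for k p by (auto simp: f_def)
  have fX: "f \<in> cont_funs X" using g f by (auto simp: mem_X_iff V_cont intro: LIMSEQ_Suc)
  have "T f = g"
  proof (rule eqI[OF T_mem[OF fX]])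
    show "T f (Inr (Some (e k))) = g (Inr (Some (e k)))" for k using f g by (cases k) auto
  qed (use f g in \<open>auto simp: UV mem_X_iff\<close>)
  then show "g \<in> T ` cont_funs X" using fX by blast
qed

lemma cont_funs_add: "F \<in> cont_funs Y \<Longrightarrow> G \<in> cont_funs Y \<Longrightarrow> (\<lambda>z. F z + G z) \<in> cont_funs Y"
  and cont_funs_scale: "F \<in> cont_funs Y \<Longrightarrow> (\<lambda>z. c * F z) \<in> cont_funs Y"
  for F G :: "'c \<Rightarrow> 'k"
  by (auto simp: cont_funs_def intro!: continuous_map_add continuous_map_mult)

lemma zero_mem: "(\<lambda>_. 0) \<in> cont_funs Y"
  by (simp add: cont_funs_def)

lemma \<mu>_zero: "\<mu> (\<lambda>_. 0) = 0"
  using \<mu>_bound[OF zero_mem, of 0] by simp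

lemma T_add:
  assumes "f \<in> cont_funs X" "g \<in> cont_funs X"
  shows "T (\<lambda>x. f x + g x) = (\<lambda>x. T f x + T g x)"
proof (rule eqI)
  have *: "(\<lambda>x. f x + g x) \<circ> Inl = (\<lambda>z. (f \<circ> Inl) z + (g \<circ> Inl) z)" by auto
  show "T (\<lambda>x. f x + g x) \<circ> Inl = (\<lambda>x. T f x + T g x) \<circ> Inl"
    using fun_cong[OF T_simps(1)] by (auto simp only: T_simps * U_linear o_def)
  show "T (\<lambda>x. f x + g x) (Inr (Some (e k))) = T f (Inr (Some (e k))) + T g (Inr (Some (e k)))" for k
    using assms \<mu>_add[of "f \<circ> Inl" "g \<circ> Inl"] by (cases k) (simp_all add: mem_X_iff o_def)
qed (use assms in \<open>auto intro: T_mem cont_funs_add\<close>)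

lemma T_scale:
  assumes "f \<in> cont_funs X"
  shows "T (\<lambda>x. c * f x) = (\<lambda>x. c * T f x)"
proof (rule eqI)
  have *: "(\<lambda>x. c * f x) \<circ> Inl = (\<lambda>z. c * (f \<circ> Inl) z)" by auto
  show "T (\<lambda>x. c * f x) \<circ> Inl = (\<lambda>x. c * T f x) \<circ> Inl"
    using fun_cong[OF T_simps(1)] by (auto simp only: T_simps * U_linear o_def)
  show "T (\<lambda>x. c * f x) (Inr (Some (e k))) = c * T f (Inr (Some (e k)))" for k
    using assms \<mu>_scale[of "f \<circ> Inl" c] by (cases k) (simp_all add: mem_X_iff o_def)
qed (use assms in \<open>auto intro: T_mem cont_funs_scale\<close>)

lemma bound_iff:
  "(\<forall>x\<in>topspace X. norm (f x) \<le> B) \<longleftrightarrow>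
    (\<forall>z\<in>topspace Z. norm ((f \<circ> Inl) z) \<le> B) \<and> norm (f (Inr None)) \<le> B \<and> (\<forall>k. norm (f (Inr (Some (e k)))) \<le> B)"
  by (auto simp: X_def topspace_disjoint_sum elim: in_N)

text \<open>\<open>f\<close> and \<open>T f\<close> have the same upper bounds: \<open>U\<close>
  only permutes moduli, the sequence is only moved, and the inserted value obeys every bound valid
  on \<open>Z\<close>.\<close>

lemma sup_norm_T:
  assumes "f \<in> cont_funs X"
  shows "sup_norm X (T f) = sup_norm X f"
proof -
  have "(\<forall>x\<in>topspace X. norm (T f x) \<le> B) \<longleftrightarrow> (\<forall>x\<in>topspace X. norm (f x) \<le> B)" for B
  proof -
    have "(\<forall>k. norm (T f (Inr (Some (e k)))) \<le> B) \<longleftrightarrow>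
        norm (\<mu> (f \<circ> Inl)) \<le> B \<and> (\<forall>k. norm (f (Inr (Some (e k)))) \<le> B)"
    proof -
      have split: "(\<forall>k. P k) \<longleftrightarrow> P 0 \<and> (\<forall>k. P (Suc k))" for P :: "nat \<Rightarrow> bool"
        using not0_implies_Suc by metis
      show ?thesis by (subst split) simp
    qed
    moreover have "norm (\<mu> (f \<circ> Inl)) \<le> B" if "\<forall>z\<in>topspace Z. norm ((f \<circ> Inl) z) \<le> B"
      using \<mu>_bound[of "f \<circ> Inl" B] assms that by (auto simp: mem_X_iff)
    ultimately show ?thesis unfolding bound_iff T_simps U_bound_iff by blast
  qed
  \<comment> \<open>The real supremum is by definition the least upper bound, so it depends only on
    the set of upper bounds.\<close>
  then show ?thesis unfolding sup_norm_def Sup_real_def by simp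
qed

text \<open>The indicator of the first isolated point represents a basis of the quotient.
  Subtracting \<open>c\<close> times it leaves the part on \<open>Z\<close> alone, so the range
  condition becomes an equation with exactly one solution \<open>c\<close>.\<close>

lemma has_codimension_range_T: "has_codimension (cont_funs X) (T ` cont_funs X) 1"
  unfolding has_codimension_def
proof (intro exI conjI ballI allI impI)
  let ?p = "Inr (Some (e 0)) :: 'a + 'n option"
  define b where "b i = (\<lambda>x. if x = ?p then 1 else 0 :: 'k)" for i :: nat
  have b: "b i \<in> cont_funs X" for i
  proof -
    have "inj e" using e by (simp add: bij_betw_def)
    then have "b i (Inr (Some (e (Suc k)))) = 0" for k by (auto simp: b_def inj_eq)
    then have "(\<lambda>k. b i (Inr (Some (e (Suc k))))) \<longlonglongrightarrow> 0" by simp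
    then have "(\<lambda>k. b i (Inr (Some (e k)))) \<longlonglongrightarrow> 0" by (rule LIMSEQ_imp_Suc)
    moreover have "b i \<circ> Inl = (\<lambda>_. 0)" by (auto simp: b_def)
    moreover have "p \<notin> N \<Longrightarrow> b i (Inr (Some p)) = 0" for p by (auto simp: b_def)
    ultimately show ?thesis by (auto simp: mem_X_iff zero_mem) (simp add: b_def)
  qed
  show "b i \<in> cont_funs X" for i by (rule b)
  fix f :: "'a + 'n option \<Rightarrow> 'k" assume f: "f \<in> cont_funs X"
  define a where "a = f ?p - \<mu> (V (f \<circ> Inl))"
  have "(\<lambda>x. f x - c * b 0 x) \<in> T ` cont_funs X \<longleftrightarrow> c = a" for c
  proof -
    have "(\<lambda>x. f x + - c * b 0 x) \<in> cont_funs X" using f b by (intro cont_funs_add cont_funs_scale)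
    moreover have "(\<lambda>x. f x - c * b 0 x) \<circ> Inl = f \<circ> Inl" by (auto simp: b_def)
    ultimately show ?thesis by (auto simp: range_T_iff b_def a_def algebra_simps)
  qed
  then have *: "(\<lambda>x. f x - (\<Sum>i<1. c i * b i x)) \<in> T ` cont_funs X \<longleftrightarrow> c 0 = a" for c by simp
  show "\<exists>!c. c \<in> extensional {..<1} \<and> (\<lambda>x. f x - (\<Sum>i<1. c i * b i x)) \<in> T ` cont_funs X"
    unfolding *
  proof (rule ex1I)
    show "restrict (\<lambda>_. a) {..<1} \<in> extensional {..<1::nat} \<and> restrict (\<lambda>_. a) {..<1} (0::nat) = a" by simp
    fix c :: "nat \<Rightarrow> 'k" assume "c \<in> extensional {..<1} \<and> c 0 = a"
    then show "c = restrict (\<lambda>_. a) {..<1}" by (auto simp: extensional_def fun_eq_iff)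
  qed
qed

lemma T_iter_mem: "f \<in> cont_funs X \<Longrightarrow> (T ^^ n) f \<in> cont_funs X"
  by (induction n) (auto intro: T_mem)

lemma V_iter_T_iter: "f \<in> cont_funs X \<Longrightarrow> (V ^^ n) ((T ^^ n) f \<circ> Inl) = f \<circ> Inl"
proof (induction n)
  case (Suc n)
  have mem: "(T ^^ n) f \<circ> Inl \<in> cont_funs Z" using T_iter_mem[OF Suc.prems] mem_X_iff by blast
  have V: "(V ^^ Suc n) G = (V ^^ n) (V G)" for G by (simp only: funpow_Suc_right o_apply)
  have T: "(T ^^ Suc n) f = T ((T ^^ n) f)" by simp
  show ?case unfolding V T T_simps(1) VU[OF mem] by (rule Suc.IH[OF Suc.prems])
qed simp

lemma T_iter_seq: "(T ^^ n) f (Inr (Some (e (n + k)))) = f (Inr (Some (e k)))"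
  by (induction n arbitrary: k) simp_all

lemma isometric_shift_T:
  assumes orbit: "\<And>F v. F \<in> cont_funs Z \<Longrightarrow> (\<lambda>n. \<mu> ((V ^^ n) F)) \<longlonglongrightarrow> v \<Longrightarrow> F = (\<lambda>_. 0)"
  shows "isometric_shift (cont_funs X) (sup_norm X) T"
proof -
  have "g = (\<lambda>_. 0)" if g: "g \<in> (\<Inter>n\<in>{1..}. (T ^^ n) ` cont_funs X)" for g
  proof -
    have "g \<in> (T ^^ 1) ` cont_funs X" using g by blast
    then have gX: "g \<in> cont_funs X" using T_mem by auto
    \<comment> \<open>Write \<open>g\<close> as the image of \<open>f\<close> under
      \<open>n + 1\<close> applications of \<open>T\<close>. The first application places
      \<open>\<mu> (f \<circ> Inl)\<close> at index 0 and the remaining \<open>n\<close> carry it to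
      index \<open>n\<close>; on \<open>Z\<close>, \<open>f\<close> is recovered from
      \<open>g\<close> by \<open>n + 1\<close> applications of \<open>V\<close>.\<close>
    have seq: "g (Inr (Some (e n))) = \<mu> ((V ^^ Suc n) (g \<circ> Inl))" for n
    proof -
      have "g \<in> (T ^^ Suc n) ` cont_funs X" by (rule INT_D[OF g]) simp
      then obtain f where f: "f \<in> cont_funs X" "g = (T ^^ Suc n) f" by blast
      have "g (Inr (Some (e n))) = (T ^^ n) (T f) (Inr (Some (e (n + 0))))"
        unfolding f(2) by (simp add: funpow_Suc_right del: funpow.simps(2))
      also have "\<dots> = \<mu> (f \<circ> Inl)" by (simp only: T_iter_seq T_simps)
      finally show ?thesis using V_iter_T_iter[OF f(1), of "Suc n"] f(2) by simp
    qed
    have "(\<lambda>n. \<mu> ((V ^^ Suc n) (g \<circ> Inl))) \<longlonglongrightarrow> g (Inr None)"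
      using gX unfolding seq[symmetric] by (simp add: mem_X_iff)
    then have lim: "(\<lambda>n. \<mu> ((V ^^ n) (g \<circ> Inl))) \<longlonglongrightarrow> g (Inr None)" by (rule LIMSEQ_imp_Suc)
    then have 0: "g \<circ> Inl = (\<lambda>_. 0)" using orbit gX by (auto simp: mem_X_iff)
    \<comment> \<open>Once \<open>g\<close> vanishes on \<open>Z\<close>, all its sequence values
      are \<open>\<mu>\<close> of 0, and so their limit is 0 too.\<close>
    have "(V ^^ n) (\<lambda>_. 0) = (\<lambda>_. 0)" for n by (induction n) (auto simp: V_def)
    then have s0: "\<mu> ((V ^^ n) (g \<circ> Inl)) = 0" for n by (simp add: 0 \<mu>_zero)
    then have "g (Inr None) = 0" using lim by (simp add: LIMSEQ_const_iff)
    moreover have "g (Inr (Some (e n))) = 0" for n unfolding seq by (rule s0)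
    ultimately show ?thesis using 0 by (intro eqI[OF gX zero_mem]) (auto simp: o_def)
  qed
  moreover have "(\<lambda>_. 0) \<in> (T ^^ n) ` cont_funs X" for n
  proof -
    have "T (\<lambda>_. 0) = (\<lambda>_. 0)" using T_scale[OF zero_mem, of 0] by simp
    then have "(T ^^ n) (\<lambda>_. 0) = (\<lambda>_. 0)" by (induction n) auto
    then show ?thesis using zero_mem by (metis image_eqI)
  qed
  ultimately have "(\<Inter>n\<in>{1..}. (T ^^ n) ` cont_funs X) = {\<lambda>_. 0}" by blast
  then show ?thesis
    unfolding isometric_shift_def
    by (intro conjI ballI allI T_mem T_add T_scale sup_norm_T has_codimension_range_T)
qed

end

section \<open>Kronecker orbits\<close>

lemma continuous_map_Inl: "continuous_map X (disjoint_sum X Y) Inl"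
  and continuous_map_Inr: "continuous_map Y (disjoint_sum X Y) Inr"
proof -
  have "{x \<in> topspace X. Inl x \<in> U} = Inl -` U" "{y \<in> topspace Y. Inr y \<in> U} = Inr -` U"
    if "openin (disjoint_sum X Y) U" for U
    using openin_subset[OF that] by (auto simp: topspace_disjoint_sum)
  then show "continuous_map X (disjoint_sum X Y) Inl" "continuous_map Y (disjoint_sum X Y) Inr"
    by (auto simp: continuous_map_def topspace_disjoint_sum openin_disjoint_sum)
qed

lemma topspace_linf_max_ideal_space: "topspace linf_max_ideal_space = linf_characters"
  and linf_max_ideal_space_eq: "linf_max_ideal_space = top_of_set linf_characters"
  by (simp_all add: linf_max_ideal_space_def euclidean_product_topology)

lemma character_rot: "\<phi> \<in> linf_characters \<Longrightarrow> \<phi> \<circ> linf_rot s \<in> linf_characters"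
  by (rule linf_charactersI) (simp_all add: linf_rot_add linf_rot_scale linf_rot_mult linf_rot_one linf_charactersD)

lemma continuous_map_character_rot:
  "continuous_map linf_max_ideal_space linf_max_ideal_space (\<lambda>\<phi>. \<phi> \<circ> linf_rot s)"
proof -
  have "continuous_on linf_characters (\<lambda>\<phi>. \<phi> \<circ> linf_rot s)"
    unfolding o_def
    by (intro continuous_on_coordinatewise_then_product continuous_on_subset[OF continuous_on_product_coordinates]) simp
  then show ?thesis by (simp add: linf_max_ideal_space_eq continuous_map_in_subtopology character_rot image_subset_iff)
qed

lemma topspace_torus: "topspace (torus I) = PiE I (\<lambda>_. sphere 0 1)"
  by (simp add: torus_def)

definition torus_rot :: "'i set \<Rightarrow> ('i \<Rightarrow> complex) \<Rightarrow> ('i \<Rightarrow> complex) \<Rightarrow> 'i \<Rightarrow> complex" where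
  "torus_rot I c x = (\<lambda>i\<in>I. c i * x i)"

lemma continuous_map_torus_rot:
  assumes "\<And>i. i \<in> I \<Longrightarrow> norm (c i) = 1"
  shows "continuous_map (torus I) (torus I) (torus_rot I c)"
proof -
  have "continuous_map (torus I) (top_of_set (sphere 0 1)) (\<lambda>x. c i * x i)" if "i \<in> I" for i
  proof -
    have "continuous_map (torus I) (top_of_set (sphere 0 1)) (\<lambda>x. x i)"
      unfolding torus_def by (rule continuous_map_product_projection[OF that])
    then have "continuous_map (torus I) euclidean (\<lambda>x. x i)" by (simp add: continuous_map_in_subtopology)
    then have "continuous_map (torus I) euclidean (\<lambda>x. c i * x i)"
      by (intro continuous_map_mult) auto
    then show ?thesis using assms[OF that] that
      by (auto simp: continuous_map_in_subtopology topspace_torus norm_mult PiE_iff)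
  qed
  then show ?thesis
    unfolding torus_def[of I] continuous_map_componentwise
    unfolding torus_def[of I, symmetric]
    by (auto simp: torus_rot_def)
qed

text \<open>Basic neighbourhoods in the product restrict finitely many coordinates only. This is
  what lets Kronecker's theorem, a statement on finitely many angles, act on a torus of any
  dimension.\<close>

lemma torus_continuousD:
  fixes H :: "('i \<Rightarrow> complex) \<Rightarrow> complex"
  assumes H: "continuous_map (torus I) euclidean H" and x: "x \<in> topspace (torus I)" and "e > 0"
  obtains J \<delta> where "finite J" "J \<subseteq> I" "\<delta> > 0"
    and "\<And>y. y \<in> topspace (torus I) \<Longrightarrow> (\<And>i. i \<in> J \<Longrightarrow> dist (y i) (x i) < \<delta>) \<Longrightarrow> dist (H y) (H x) < e"
proof -
  have "openin (torus I) {y \<in> topspace (torus I). H y \<in> ball (H x) e}"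
    by (rule openin_continuous_map_preimage[OF H]) simp
  moreover have "x \<in> {y \<in> topspace (torus I). H y \<in> ball (H x) e}" using x \<open>e > 0\<close> by simp
  ultimately obtain U where U: "finite {i \<in> I. U i \<noteq> sphere 0 1}"
    "\<And>i. i \<in> I \<Longrightarrow> openin (top_of_set (sphere 0 1)) (U i)" "x \<in> PiE I U"
    "PiE I U \<subseteq> {y \<in> topspace (torus I). H y \<in> ball (H x) e}"
    unfolding torus_def openin_product_topology_alt by (auto simp del: mem_ball)
  define J where "J = {i \<in> I. U i \<noteq> sphere 0 1}"
  have "\<exists>d>0. \<forall>w\<in>sphere 0 1. dist w (x i) < d \<longrightarrow> w \<in> U i" if "i \<in> J" for i
  proof -
    have "openin (top_of_set (sphere 0 1)) (U i)" "x i \<in> U i" using U that by (auto simp: J_def)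
    then show ?thesis unfolding openin_euclidean_subtopology_iff by blast
  qed
  then obtain d where d: "\<And>i. i \<in> J \<Longrightarrow> d i > 0" "\<And>i w. \<lbrakk>i \<in> J; w \<in> sphere 0 1; dist w (x i) < d i\<rbrakk> \<Longrightarrow> w \<in> U i"
    by metis
  \<comment> \<open>The entry 1 keeps the minimum defined when \<open>J\<close> is empty.\<close>
  define \<delta> where "\<delta> = Min (insert 1 (d ` J))"
  have J: "finite J" using U(1) by (simp add: J_def)
  show ?thesis
  proof
    show "finite J" by (rule J)
    show "J \<subseteq> I" by (auto simp: J_def)
    show "\<delta> > 0" using J d(1) by (simp add: \<delta>_def)
    fix y assume y: "y \<in> topspace (torus I)" "\<And>i. i \<in> J \<Longrightarrow> dist (y i) (x i) < \<delta>"
    have "y i \<in> U i" if "i \<in> I" for i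
    proof (cases "i \<in> J")
      case True
      then have "\<delta> \<le> d i" using J by (auto simp: \<delta>_def)
      with y(2)[OF True] have "dist (y i) (x i) < d i" by simp
      moreover have "y i \<in> sphere 0 1" using y(1) that unfolding topspace_torus by (rule PiE_mem)
      ultimately show ?thesis using d(2) True by blast
    next
      case False
      then have "U i = sphere 0 1" using that by (simp add: J_def)
      then show ?thesis using y(1) that unfolding topspace_torus by (metis PiE_mem)
    qed
    then have "y \<in> PiE I U" using y(1) by (auto simp: topspace_torus PiE_iff)
    then show "dist (H y) (H x) < e" using U(4) by (auto simp: dist_commute)
  qed
qed

text \<open>
  By Kronecker's theorem the orbit comes near \<open>(s, x)\<close> and near \<open>(s + 2 * pi, x)\<close>, both at even and at
  odd times, so \<open>\<plusminus> \<Phi> s \<plusminus> H x\<close> equals the limit for three of the choices of signs.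
\<close>
lemma orbit_limit_zero:
  fixes \<Phi> :: "real \<Rightarrow> complex" and H :: "('i \<Rightarrow> complex) \<Rightarrow> complex" and idx :: "'i \<Rightarrow> real"
  assumes H: "continuous_map (torus I) euclidean H"
    and \<Phi>_period: "\<And>s k. \<Phi> (s + of_int k * (2 * pi)) = (if even k then 1 else - 1) * \<Phi> s"
    and \<Phi>_cont: "continuous_on {0<..<2 * pi} \<Phi>"
    and idx: "inj_on idx I" "\<And>i. i \<in> I \<Longrightarrow> idx i \<noteq> 0"
    and lim: "(\<lambda>n. \<Phi> (real n * (2 * pi * lacunary 0)) + (- 1) ^ n * H (\<lambda>i\<in>I. cis (pi * real n * lacunary (idx i)))) \<longlonglongrightarrow> L"
    and s: "0 < s" "s < 2 * pi" and x: "x \<in> topspace (torus I)"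
  shows "\<Phi> s = 0" "H x = 0"
proof -
  define \<theta> where "\<theta> = 2 * pi * lacunary 0"
  define pt where "pt n = (\<lambda>i\<in>I. cis (pi * real n * lacunary (idx i)))" for n
  \<comment> \<open>\<open>q\<close> counts an extra full turn of the translation and
    \<open>p\<close> fixes the parity of the time. The bound \<open>3 * e\<close> adds the errors
    from the limit, from \<open>\<Phi>\<close> and from \<open>H\<close>.\<close>
  have close: "dist ((if q = 0 then 1 else - 1) * \<Phi> s + (- 1) ^ p * H x) L \<le> 3 * e"
    if "e > 0" and q: "q \<in> {0, 1 :: int}" for e q and p :: nat
  proof -
    obtain M where M: "\<And>n. n \<ge> M \<Longrightarrow> dist (\<Phi> (real n * \<theta>) + (- 1) ^ n * H (pt n)) L < e"
      using lim[unfolded \<theta>_def[symmetric] pt_def[symmetric]] \<open>e > 0\<close> unfolding lim_sequentially by metis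
    obtain J \<delta> where J: "finite J" "J \<subseteq> I" "\<delta> > 0"
      "\<And>y. y \<in> topspace (torus I) \<Longrightarrow> (\<And>i. i \<in> J \<Longrightarrow> dist (y i) (x i) < \<delta>) \<Longrightarrow> dist (H y) (H x) < e"
      by (rule torus_continuousD[OF H x \<open>e > 0\<close>]) blast
    have "isCont \<Phi> s" using \<Phi>_cont s by (simp add: continuous_on_eq_continuous_at)
    then obtain d1 where d1: "d1 > 0" "\<And>r. dist r s < d1 \<Longrightarrow> dist (\<Phi> r) (\<Phi> s) < e"
      using \<open>e > 0\<close> unfolding continuous_at_eps_delta by (metis dist_commute)
    have "continuous_on UNIV (\<lambda>t. cis t)" by (intro continuous_intros)
    then have "isCont cis 0" by (simp add: continuous_on_eq_continuous_at)
    then obtain d2 where d2: "d2 > 0" "\<And>r. dist r 0 < d2 \<Longrightarrow> dist (cis r) (cis 0) < \<delta>"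
      using \<open>\<delta> > 0\<close> unfolding continuous_at_eps_delta by metis
    \<comment> \<open>An error \<open>\<eta>\<close> in the approximation becomes
      \<open>4 * pi * \<eta>\<close> in the translation and \<open>2 * pi * \<eta>\<close> in a
      torus coordinate.\<close>
    define \<epsilon> where "\<epsilon> = min (d1 / (4 * pi)) (d2 / (2 * pi))"
    have \<epsilon>: "\<epsilon> > 0" "4 * pi * \<epsilon> \<le> d1" "2 * pi * \<epsilon> \<le> d2"
      using d1(1) d2(1) by (auto simp: \<epsilon>_def field_simps min_def)
    \<comment> \<open>Targets for \<open>m\<close> when the time is \<open>n = 2 * m + p\<close>.
      Dividing by \<open>4 * pi\<close> at index 0 controls the translation modulo two full turns,
      so an even number \<open>2 * k 0\<close> of turns is left over and the sign of
      \<open>\<Phi>\<close> depends on \<open>q\<close> alone. The offsets with \<open>p\<close>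
      cancel the contribution of the odd step.\<close>
    define \<alpha> where "\<alpha> r = (if r = 0 then (s + of_int q * (2 * pi) - real p * \<theta>) / (4 * pi)
        else Arg2pi (x (the_inv_into I idx r)) / (2 * pi) - real p * lacunary r / 2)" for r
    obtain m k where m: "m \<ge> M"
      and k: "\<And>r. r \<in> insert 0 (idx ` J) \<Longrightarrow> \<bar>real m * lacunary r - of_int (k r) - \<alpha> r\<bar> < \<epsilon>"
      using lacunary_multiples_dense[of "insert 0 (idx ` J)" \<epsilon> M \<alpha>] J(1) \<epsilon>(1) by (metis finite_imageI finite_insert)
    define n where "n = 2 * m + p"
    define \<eta> where "\<eta> r = real m * lacunary r - of_int (k r) - \<alpha> r" for r
    have "real n * \<theta> = (s + 4 * pi * \<eta> 0) + of_int (q + 2 * k 0) * (2 * pi)"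
      by (simp add: n_def \<eta>_def \<alpha>_def \<theta>_def field_simps)
    moreover have "even (q + 2 * k 0) \<longleftrightarrow> q = 0" using q by auto
    ultimately have \<Phi>n: "\<Phi> (real n * \<theta>) = (if q = 0 then 1 else - 1) * \<Phi> (s + 4 * pi * \<eta> 0)"
      by (simp only: \<Phi>_period)
    have "\<bar>4 * pi * \<eta> 0\<bar> < d1"
    proof -
      have "4 * pi * \<bar>\<eta> 0\<bar> < 4 * pi * \<epsilon>" using k[of 0] by (intro mult_strict_left_mono) (auto simp: \<eta>_def)
      moreover have "\<bar>4 * pi * \<eta> 0\<bar> = 4 * pi * \<bar>\<eta> 0\<bar>" by (simp add: abs_mult)
      ultimately show ?thesis using \<epsilon>(2) by linarith
    qed
    then have \<Phi>s: "dist (\<Phi> (real n * \<theta>)) ((if q = 0 then 1 else - 1) * \<Phi> s) < e"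
      using d1(2)[of "s + 4 * pi * \<eta> 0"] unfolding \<Phi>n by (auto simp: dist_norm norm_minus_commute)
    have Hs: "dist (H (pt n)) (H x) < e"
    proof (rule J(4))
      show "pt n \<in> topspace (torus I)" by (auto simp: pt_def topspace_torus)
      fix i assume i: "i \<in> J"
      then have iI: "i \<in> I" using J(2) by auto
      have \<alpha>i: "\<alpha> (idx i) = Arg2pi (x i) / (2 * pi) - real p * lacunary (idx i) / 2"
        using idx iI by (simp add: \<alpha>_def the_inv_into_f_f)
      have xi: "cis (Arg2pi (x i)) = x i"
        using PiE_mem[OF x[unfolded topspace_torus] iI] by (simp add: cis_conv_exp complex_norm_eq_1_exp)
      have "pi * real n * lacunary (idx i) = (Arg2pi (x i) + 2 * pi * \<eta> (idx i)) + of_int (k (idx i)) * (2 * pi)"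
        by (simp add: n_def \<eta>_def \<alpha>i field_simps)
      then have "pt n i = cis (Arg2pi (x i) + 2 * pi * \<eta> (idx i))"
        using iI by (simp only: pt_def restrict_apply' cis_add_2pi_int)
      also have "\<dots> = x i * cis (2 * pi * \<eta> (idx i))" by (simp only: cis_mult[symmetric] xi)
      finally have "dist (pt n i) (x i) = norm (x i * (cis (2 * pi * \<eta> (idx i)) - cis 0))"
        by (simp add: dist_norm algebra_simps)
      also have "\<dots> = dist (cis (2 * pi * \<eta> (idx i))) (cis 0)"
        using PiE_mem[OF x[unfolded topspace_torus] iI] by (simp add: norm_mult dist_norm)
      also have "\<dots> < \<delta>"
      proof (rule d2(2))
        have "2 * pi * \<bar>\<eta> (idx i)\<bar> < 2 * pi * \<epsilon>" using k[of "idx i"] i by (intro mult_strict_left_mono) (auto simp: \<eta>_def)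
        moreover have "dist (2 * pi * \<eta> (idx i)) 0 = 2 * pi * \<bar>\<eta> (idx i)\<bar>" by (simp add: abs_mult)
        ultimately show "dist (2 * pi * \<eta> (idx i)) 0 < d2" using \<epsilon>(3) by linarith
      qed
      finally show "dist (pt n i) (x i) < \<delta>" .
    qed
    have sgn: "(- 1 :: complex) ^ n = (- 1) ^ p" by (simp add: n_def power_add power_mult)
    have "dist ((- 1) ^ n * H (pt n)) ((- 1) ^ p * H x) = dist (H (pt n)) (H x)"
      unfolding sgn by (simp add: dist_norm norm_mult norm_power flip: right_diff_distrib)
    then have "dist (\<Phi> (real n * \<theta>) + (- 1) ^ n * H (pt n)) ((if q = 0 then 1 else - 1) * \<Phi> s + (- 1) ^ p * H x) < e + e"
      using \<Phi>s Hs dist_triangle_add[of "\<Phi> (real n * \<theta>)" "(- 1) ^ n * H (pt n)" "(if q = 0 then 1 else - 1) * \<Phi> s" "(- 1) ^ p * H x"]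
      by linarith
    moreover have "n \<ge> M" using m by (simp add: n_def)
    ultimately show ?thesis
      using M[of n] dist_triangle3[of "(if q = 0 then 1 else - 1) * \<Phi> s + (- 1) ^ p * H x" L "\<Phi> (real n * \<theta>) + (- 1) ^ n * H (pt n)"]
      by linarith
  qed
  have eq: "(if q = 0 then 1 else - 1) * \<Phi> s + (- 1) ^ p * H x = L" if "q \<in> {0, 1 :: int}" for q and p :: nat
  proof -
    have "dist ((if q = 0 then 1 else - 1) * \<Phi> s + (- 1) ^ p * H x) L \<le> 0 + e" if "e > 0" for e
      using close[of "e / 3" q p] that \<open>q \<in> {0, 1}\<close> by simp
    then have "dist ((if q = 0 then 1 else - 1) * \<Phi> s + (- 1) ^ p * H x) L \<le> 0" by (rule field_le_epsilon)
    then show ?thesis by simp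
  qed
  have "\<Phi> s + H x = L" "- \<Phi> s + H x = L" "\<Phi> s - H x = L" using eq[of 0 0] eq[of 1 0] eq[of 0 1] by auto
  then show "\<Phi> s = 0" "H x = 0" by (auto simp: complex_eq_iff)
qed

section \<open>The shift\<close>

text \<open>Real and complex scalars in one treatment: \<open>\<iota>\<close> is the inclusion into
  the complex numbers and \<open>\<rho>\<close> a continuous left inverse. The algebra is always
  complex, so the last two assumptions are there to bring integrals back into the scalar
  field.\<close>

locale scalar_embedding =
  fixes \<iota> :: "'k::real_normed_field \<Rightarrow> complex" and \<rho> :: "complex \<Rightarrow> 'k"
  assumes \<iota>_add: "\<iota> (a + b) = \<iota> a + \<iota> b" and \<iota>_mult: "\<iota> (a * b) = \<iota> a * \<iota> b"
    and \<iota>_of_real: "\<iota> (of_real r) = of_real r" and \<iota>_norm: "norm (\<iota> a) = norm a"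
    and \<iota>_cont: "continuous_on UNIV \<iota>" and \<rho>_cont: "continuous_on UNIV \<rho>" and \<rho>_\<iota>: "\<rho> (\<iota> a) = a"
    and \<iota>_closed: "closed (range \<iota>)"
    and \<iota>_integral: "(AE z in circle_measure. rep_linf g z \<in> range \<iota>) \<Longrightarrow> linf_integral g \<in> range \<iota>"
begin

lemma \<iota>_simps: "\<iota> 0 = 0" "\<iota> 1 = 1" "\<iota> (- 1) = - 1" "\<iota> a = 0 \<longleftrightarrow> a = 0"
  using \<iota>_of_real[of 0] \<iota>_of_real[of 1] \<iota>_of_real[of "- 1"] \<iota>_norm[of a] by auto

lemma \<iota>_minus: "\<iota> (- a) = - \<iota> a"
  using \<iota>_mult[of "- 1" a] by (simp add: \<iota>_simps)

lemma \<rho>_sign: "\<rho> 1 = 1" "\<rho> (- 1) = - 1"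
  using \<rho>_\<iota>[of 1] \<rho>_\<iota>[of "- 1"] by (simp_all add: \<iota>_simps)

end

text \<open>Injectivity of the Gelfand transform, from the norm bound applied to
  \<open>g - h\<close>.\<close>

lemma linf_eq_of_characters:
  assumes "\<And>\<phi>. \<phi> \<in> linf_characters \<Longrightarrow> \<phi> g = \<phi> h"
  shows "g = h"
proof (rule linf_eqI)
  have "AE z in circle_measure. norm (rep_linf (g - h) z) \<le> 0"
    by (rule AE_bound_of_characters) (simp add: linf_charactersD assms)
  with rep_linf_diff[of g h] show "AE z in circle_measure. rep_linf g z = rep_linf h z"
    by eventually_elim simp
qed

lemma character_linf_sign: "\<phi> \<in> linf_characters \<Longrightarrow> \<phi> (linf_sign s) = 1 \<or> \<phi> (linf_sign s) = - 1"
  using linf_charactersD(3)[of \<phi> "linf_sign s" "linf_sign s"]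
  by (simp add: linf_sign_square linf_charactersD(4) square_eq_1_iff)

lemma continuous_on_shift_integral: "continuous_on {0<..<2 * pi} (\<lambda>s. linf_integral (antiperiodic_shift s g))"
proof -
  obtain B where "B \<ge> 0" "\<And>s r. \<lbrakk>0 \<le> s; s \<le> 2 * pi; 0 \<le> r; r \<le> 2 * pi\<rbrakk> \<Longrightarrow>
    norm (linf_integral (antiperiodic_shift s g) - linf_integral (antiperiodic_shift r g)) \<le> B * \<bar>s - r\<bar>"
    by (rule linf_integral_antiperiodic_shift_lipschitz[of g]) blast
  then have "B-lipschitz_on {0<..<2 * pi} (\<lambda>s. linf_integral (antiperiodic_shift s g))"
    by (intro lipschitz_onI) (auto simp: dist_norm)
  then show ?thesis by (rule lipschitz_on_continuous_on)
qed

text \<open>Index 0 is reserved for the angle acting on the maximal ideal space, so the torus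
  coordinates use nonzero indices.\<close>

locale rotated_sum = scalar_embedding \<iota> \<rho>
  for \<iota> :: "'k::real_normed_field \<Rightarrow> complex" and \<rho> :: "complex \<Rightarrow> 'k" +
  fixes I :: "'i set" and idx :: "'i \<Rightarrow> real"
  assumes idx: "inj_on idx I" "\<And>i. i \<in> I \<Longrightarrow> idx i \<noteq> 0"
begin

definition \<theta> :: real where "\<theta> = 2 * pi * lacunary 0"

definition Z :: "((linf \<Rightarrow> complex) + ('i \<Rightarrow> complex)) topology" where
  "Z = disjoint_sum linf_max_ideal_space (torus I)"

text \<open>The argument \<open>c\<close> takes the values 1 and -1, for the homeomorphism and its
  inverse. The torus angles are \<open>pi * lacunary\<close>, so that two steps give a full
  \<open>2 * pi\<close> multiple.\<close>

definition rot :: "real \<Rightarrow> (linf \<Rightarrow> complex) + ('i \<Rightarrow> complex) \<Rightarrow> (linf \<Rightarrow> complex) + ('i \<Rightarrow> complex)" where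
  "rot c z = (case z of Inl \<phi> \<Rightarrow> Inl (\<phi> \<circ> linf_rot (c * \<theta>))
    | Inr x \<Rightarrow> Inr (torus_rot I (\<lambda>i. cis (c * (pi * lacunary (idx i)))) x))"

text \<open>On characters this is the transform of \<open>linf_sign \<theta>\<close>, with values 1
  and -1. Combined with the rotation it realises \<open>antiperiodic_shift \<theta>\<close>.\<close>

definition weight :: "(linf \<Rightarrow> complex) + ('i \<Rightarrow> complex) \<Rightarrow> 'k" where
  "weight z = (case z of Inl \<phi> \<Rightarrow> \<rho> (\<phi> (linf_sign \<theta>)) | Inr x \<Rightarrow> - 1)"

definition gelfand_inv :: "((linf \<Rightarrow> complex) + ('i \<Rightarrow> complex) \<Rightarrow> 'k) \<Rightarrow> linf" where
  "gelfand_inv F = (SOME g. \<forall>\<phi>\<in>linf_characters. \<phi> g = \<iota> (F (Inl \<phi>)))"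

text \<open>The orbit of the unit of the torus under \<open>rot 1\<close>, starting at the unit
  \<open>pt 0\<close>.\<close>

definition pt :: "nat \<Rightarrow> 'i \<Rightarrow> complex" where
  "pt n = (\<lambda>i\<in>I. cis (pi * real n * lacunary (idx i)))"

text \<open>The integral is over total length \<open>2 * pi\<close>, so the factor
  \<open>1 / (4 * pi)\<close> gives half the normalised mean; with the other half at the unit the
  norm is at most 1. Values stay complex here, and the functional of the shift is \<rho> applied to
  them.\<close>

definition mean :: "((linf \<Rightarrow> complex) + ('i \<Rightarrow> complex) \<Rightarrow> 'k) \<Rightarrow> complex" where
  "mean F = of_real (1 / (4 * pi)) * linf_integral (gelfand_inv F) + of_real (1 / 2) * \<iota> (F (Inr (pt 0)))"

lemma topspace_Z: "topspace Z = Inl ` linf_characters \<union> Inr ` topspace (torus I)"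
  by (simp add: Z_def topspace_disjoint_sum topspace_linf_max_ideal_space)

lemma pt_in: "pt n \<in> topspace (torus I)"
  by (auto simp: pt_def topspace_torus)

lemma homeomorphic_maps_rot: "homeomorphic_maps Z Z (rot 1) (rot (- 1))"
proof -
  have "continuous_map Z Z (rot c)" for c
    unfolding Z_def continuous_map_disjoint_sum
  proof
    have "rot c \<circ> Inl = Inl \<circ> (\<lambda>\<phi>. \<phi> \<circ> linf_rot (c * \<theta>))" by (auto simp: rot_def)
    then show "continuous_map linf_max_ideal_space (disjoint_sum linf_max_ideal_space (torus I)) (rot c \<circ> Inl)"
      by (metis continuous_map_compose[OF continuous_map_character_rot continuous_map_Inl])
    have "rot c \<circ> Inr = Inr \<circ> torus_rot I (\<lambda>i. cis (c * (pi * lacunary (idx i))))" by (auto simp: rot_def)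
    then show "continuous_map (torus I) (disjoint_sum linf_max_ideal_space (torus I)) (rot c \<circ> Inr)"
      by (metis continuous_map_compose[OF continuous_map_torus_rot continuous_map_Inr] norm_cis)
  qed
  moreover have "rot c (rot d z) = z" if "c + d = 0" "z \<in> topspace Z" for c d z
  proof (cases z)
    case (Inl \<phi>)
    have "d * \<theta> + c * \<theta> = 0" using that(1) by (simp add: add.commute flip: distrib_right)
    then show ?thesis by (simp add: Inl rot_def fun_eq_iff linf_rot_rot linf_rot_0)
  next
    case (Inr x)
    then have x: "x \<in> extensional I" using that(2) by (auto simp: topspace_Z topspace_torus PiE_iff)
    have "cis (c * r) * (cis (d * r) * w) = w" for r w
    proof -
      have "cis (c * r) * cis (d * r) = 1" using that(1) by (simp add: cis_mult flip: distrib_right)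
      then show ?thesis by (simp add: mult.assoc[symmetric])
    qed
    then show ?thesis using x by (auto simp: Inr rot_def torus_rot_def extensional_def fun_eq_iff)
  qed
  ultimately show ?thesis by (simp add: homeomorphic_maps_def)
qed

lemma continuous_map_weight: "continuous_map Z euclidean weight"
  unfolding Z_def continuous_map_disjoint_sum
proof
  have "continuous_on linf_characters (\<lambda>\<phi>. \<rho> (\<phi> (linf_sign \<theta>)))"
    by (rule continuous_on_compose2[OF \<rho>_cont continuous_on_subset[OF continuous_on_product_coordinates]]) auto
  then show "continuous_map linf_max_ideal_space euclidean (weight \<circ> Inl)"
    by (simp add: linf_max_ideal_space_eq weight_def o_def)
  show "continuous_map (torus I) euclidean (weight \<circ> Inr)" by (simp add: weight_def o_def)
qed

lemma weight_sign: "z \<in> topspace Z \<Longrightarrow> weight z = 1 \<or> weight z = - 1"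
  using character_linf_sign by (auto simp: topspace_Z weight_def \<rho>_sign) (metis \<rho>_sign)

lemma gelfand_inv:
  assumes "F \<in> cont_funs Z" "\<phi> \<in> linf_characters"
  shows "\<phi> (gelfand_inv F) = \<iota> (F (Inl \<phi>))"
proof -
  have "continuous_map linf_max_ideal_space euclidean (F \<circ> Inl)"
    using assms(1) by (simp add: cont_funs_def Z_def continuous_map_disjoint_sum)
  then have "continuous_on linf_characters (\<lambda>\<phi>. F (Inl \<phi>))" by (simp add: linf_max_ideal_space_eq o_def)
  then have "continuous_on linf_characters (\<lambda>\<phi>. \<iota> (F (Inl \<phi>)))"
    by (rule continuous_on_compose2[OF \<iota>_cont]) auto
  then obtain g where "\<And>\<phi>. \<phi> \<in> linf_characters \<Longrightarrow> \<phi> g = \<iota> (F (Inl \<phi>))"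
    by (rule gelfand_surjective) blast
  then have "\<exists>g. \<forall>\<phi>\<in>linf_characters. \<phi> g = \<iota> (F (Inl \<phi>))" by blast
  from someI_ex[OF this] show ?thesis using assms(2) unfolding gelfand_inv_def by blast
qed

lemma gelfand_inv_eqI:
  "F \<in> cont_funs Z \<Longrightarrow> (\<And>\<phi>. \<phi> \<in> linf_characters \<Longrightarrow> \<phi> g = \<iota> (F (Inl \<phi>))) \<Longrightarrow> gelfand_inv F = g"
  by (rule linf_eq_of_characters) (simp add: gelfand_inv)

text \<open>All characters map \<open>gelfand_inv F\<close> into the closed range of
  \<open>\<iota>\<close>. So its representative lies there almost everywhere, and the integral stays
  in the scalar field.\<close>

lemma \<iota>_\<rho>_mean:
  assumes "F \<in> cont_funs Z"
  shows "\<iota> (\<rho> (mean F)) = mean F"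
proof -
  have "AE z in circle_measure. rep_linf (gelfand_inv F) z \<in> range \<iota>"
    by (rule AE_in_closed_of_characters[OF \<iota>_closed]) (simp add: gelfand_inv[OF assms])
  then obtain a where "linf_integral (gelfand_inv F) = \<iota> a" using \<iota>_integral by blast
  then have "mean F = \<iota> (of_real (1 / (4 * pi)) * a + of_real (1 / 2) * F (Inr (pt 0)))"
    by (simp only: mean_def \<iota>_add \<iota>_mult \<iota>_of_real)
  then show ?thesis by (simp only: \<rho>_\<iota>)
qed

lemma norm_mean_le:
  assumes "F \<in> cont_funs Z" "\<And>z. z \<in> topspace Z \<Longrightarrow> norm (F z) \<le> B"
  shows "norm (mean F) \<le> B"
proof -
  have "AE z in circle_measure. norm (rep_linf (gelfand_inv F) z) \<le> B"
    by (rule AE_bound_of_characters) (use assms in \<open>simp add: gelfand_inv \<iota>_norm topspace_Z\<close>)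
  then have "norm (linf_integral (gelfand_inv F)) \<le> B * (2 * pi)" by (rule linf_integral_bound)
  then have "norm (of_real (1 / (4 * pi)) * linf_integral (gelfand_inv F)) \<le> B / 2"
    by (simp add: norm_mult norm_divide field_simps)
  moreover have "norm (of_real (1 / 2) * \<iota> (F (Inr (pt 0)))) \<le> B / 2"
    using assms(2)[of "Inr (pt 0)"] pt_in by (simp add: norm_mult norm_divide \<iota>_norm topspace_Z)
  ultimately show ?thesis unfolding mean_def by (intro order_trans[OF norm_triangle_ineq]) linarith
qed

lemma mean_add:
  assumes "F \<in> cont_funs Z" "G \<in> cont_funs Z" "(\<lambda>z. F z + G z) \<in> cont_funs Z"
  shows "mean (\<lambda>z. F z + G z) = mean F + mean G"
proof -
  have "gelfand_inv (\<lambda>z. F z + G z) = gelfand_inv F + gelfand_inv G"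
    by (rule gelfand_inv_eqI) (use assms in \<open>simp_all add: linf_charactersD gelfand_inv \<iota>_add\<close>)
  then show ?thesis by (simp add: mean_def linf_integral_add \<iota>_add algebra_simps add_divide_distrib)
qed

lemma mean_scale:
  assumes "F \<in> cont_funs Z" "(\<lambda>z. c * F z) \<in> cont_funs Z"
  shows "mean (\<lambda>z. c * F z) = \<iota> c * mean F"
proof -
  have "gelfand_inv (\<lambda>z. c * F z) = linf_scale (\<iota> c) (gelfand_inv F)"
    by (rule gelfand_inv_eqI) (use assms in \<open>simp_all add: linf_charactersD gelfand_inv \<iota>_mult\<close>)
  then show ?thesis by (simp add: mean_def linf_integral_scale \<iota>_mult algebra_simps)
qed

lemma admits_isometric_shift_sum:
  fixes N :: "'n set"
  assumes "countable N" "infinite N"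
  defines "X \<equiv> disjoint_sum Z (Alexandroff_compactification (discrete_topology N))"
  shows "admits_isometric_shift (cont_funs X :: (_ \<Rightarrow> 'k) set) (sup_norm X)"
proof -
  obtain e :: "nat \<Rightarrow> 'n" where e: "bij_betw e UNIV N"
    using assms(1,2) by (metis bij_betw_from_nat_into)
  have \<mu>_eqI: "\<rho> w = c" if "w = \<iota> c" for w c using that by (simp add: \<rho>_\<iota>)
  interpret S: shift_data Z N e "rot 1" "rot (- 1)" weight "\<lambda>F. \<rho> (mean F)"
  proof
    fix F G :: "(linf \<Rightarrow> complex) + ('i \<Rightarrow> complex) \<Rightarrow> 'k" and c :: 'k and B :: real
    assume F: "F \<in> cont_funs Z"
    have cF: "(\<lambda>z. c * F z) \<in> cont_funs Z"
      using F by (auto simp: cont_funs_def intro!: continuous_map_mult)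
    show "\<rho> (mean (\<lambda>z. c * F z)) = c * \<rho> (mean F)"
      by (rule \<mu>_eqI) (simp add: mean_scale[OF F cF] \<iota>_mult \<iota>_\<rho>_mean[OF F])
    show "norm (\<rho> (mean F)) \<le> B" if "\<And>z. z \<in> topspace Z \<Longrightarrow> norm (F z) \<le> B"
      using norm_mean_le[OF F that] \<iota>_\<rho>_mean[OF F] by (metis \<iota>_norm)
    assume G: "G \<in> cont_funs Z"
    have FG: "(\<lambda>z. F z + G z) \<in> cont_funs Z"
      using F G by (auto simp: cont_funs_def intro!: continuous_map_add)
    show "\<rho> (mean (\<lambda>z. F z + G z)) = \<rho> (mean F) + \<rho> (mean G)"
      by (rule \<mu>_eqI) (simp add: mean_add[OF F G FG] \<iota>_add \<iota>_\<rho>_mean[OF F] \<iota>_\<rho>_mean[OF G])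
  qed (use e homeomorphic_maps_rot continuous_map_weight weight_sign in auto)
  have orbit: "F = (\<lambda>_. 0)" if F: "F \<in> cont_funs Z" and lim: "(\<lambda>n. \<rho> (mean ((S.V ^^ n) F))) \<longlonglongrightarrow> v" for F v
  proof -
    define g where "g = gelfand_inv F"
    have mem: "(S.V ^^ n) F \<in> cont_funs Z" for n
      by (induction n) (simp_all add: F S.V_cont)
    \<comment> \<open>On the algebra side, \<open>n\<close> steps of \<open>V\<close> are the
      antiperiodic translation by \<open>n * \<theta>\<close>.\<close>
    have gel: "gelfand_inv ((S.V ^^ n) F) = antiperiodic_shift (real n * \<theta>) g" for n
    proof (induction n)
      case (Suc n)
      have "gelfand_inv (S.V ((S.V ^^ n) F)) = antiperiodic_shift \<theta> (gelfand_inv ((S.V ^^ n) F))"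
      proof (rule gelfand_inv_eqI[OF S.V_cont[OF mem]])
        fix \<phi> assume \<phi>: "\<phi> \<in> linf_characters"
        have "\<iota> (\<rho> (\<phi> (linf_sign \<theta>))) = \<phi> (linf_sign \<theta>)"
          using character_linf_sign[OF \<phi>, of \<theta>] by (auto simp: \<rho>_sign \<iota>_simps)
        then show "\<phi> (antiperiodic_shift \<theta> (gelfand_inv ((S.V ^^ n) F))) = \<iota> (S.V ((S.V ^^ n) F) (Inl \<phi>))"
          using gelfand_inv[OF mem character_rot[OF \<phi>]] \<phi>
          by (simp add: S.V_def topspace_Z weight_def rot_def \<iota>_mult antiperiodic_shift_def linf_charactersD[OF \<phi>])
      qed
      then show ?case by (simp add: Suc antiperiodic_shift_shift algebra_simps)
    qed (simp add: g_def antiperiodic_shift_0)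
    \<comment> \<open>Peeling off the outermost \<open>V\<close> moves the evaluation point one step
      along the orbit, so the induction needs arbitrary \<open>m\<close>.\<close>
    have tor: "(S.V ^^ n) F (Inr (pt m)) = (- 1) ^ n * F (Inr (pt (m + n)))" for n m
    proof (induction n arbitrary: m)
      case (Suc n)
      have "torus_rot I (\<lambda>i. cis (1 * (pi * lacunary (idx i)))) (pt m) = pt (Suc m)"
        by (auto simp: torus_rot_def pt_def cis_mult algebra_simps)
      then have "(S.V ^^ Suc n) F (Inr (pt m)) = - (S.V ^^ n) F (Inr (pt (Suc m)))"
        using pt_in[of m] by (simp add: S.V_def topspace_Z weight_def rot_def)
      then show ?case by (simp add: Suc)
    qed simp
    define \<Phi> where "\<Phi> s = of_real (1 / (4 * pi)) * linf_integral (antiperiodic_shift s g)" for s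
    define H where "H x = of_real (1 / 2) * \<iota> (F (Inr x))" for x
    have "\<iota> ((- 1) ^ n) = (- 1) ^ n" for n by (induction n) (simp_all add: \<iota>_minus \<iota>_simps)
    then have "mean ((S.V ^^ n) F) = \<Phi> (real n * \<theta>) + (- 1) ^ n * H (pt n)" for n
      by (simp add: mean_def gel tor \<Phi>_def H_def \<iota>_mult)
    moreover have "(\<lambda>n. \<iota> (\<rho> (mean ((S.V ^^ n) F)))) \<longlonglongrightarrow> \<iota> v"
      by (rule continuous_on_tendsto_compose[OF \<iota>_cont lim]) auto
    then have "(\<lambda>n. mean ((S.V ^^ n) F)) \<longlonglongrightarrow> \<iota> v" by (simp only: \<iota>_\<rho>_mean[OF mem])
    ultimately have lim': "(\<lambda>n. \<Phi> (real n * \<theta>) + (- 1) ^ n * H (pt n)) \<longlonglongrightarrow> \<iota> v"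
      by simp
    have Hc: "continuous_map (torus I) euclidean H"
    proof -
      have "continuous_map (torus I) euclidean (\<iota> \<circ> (F \<circ> Inr))"
        using F \<iota>_cont by (intro continuous_map_compose[where X' = euclidean]) (auto simp: cont_funs_def Z_def continuous_map_disjoint_sum)
      then show ?thesis unfolding H_def o_def by (intro continuous_map_mult) auto
    qed
    have \<Phi>c: "continuous_on {0<..<2 * pi} \<Phi>"
      unfolding \<Phi>_def by (intro continuous_intros continuous_on_shift_integral)
    have \<Phi>p: "\<Phi> (s + of_int k * (2 * pi)) = (if even k then 1 else - 1) * \<Phi> s" for s k
      unfolding \<Phi>_def linf_integral_antiperiodic_shift_period by simp
    have zero: "\<Phi> s = 0" "H x = 0" if "0 < s" "s < 2 * pi" "x \<in> topspace (torus I)" for s x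
      by (rule orbit_limit_zero[OF Hc \<Phi>p \<Phi>c idx(1) _ lim'[unfolded \<theta>_def pt_def] that], erule idx(2))+
    \<comment> \<open>\<open>orbit_limit_zero\<close> takes an angle and a torus point together. An
      orbit point fills the second place here, and the angle \<open>pi\<close> fills the first one
      below.\<close>
    have "linf_integral (antiperiodic_shift s g) = 0" if "0 < s" "s < 2 * pi" for s
      using zero(1)[OF that pt_in] by (simp add: \<Phi>_def)
    then have "g = 0" by (rule linf_eq_zero_if_shift_integrals_zero)
    have "F (Inl \<phi>) = 0" if "\<phi> \<in> linf_characters" for \<phi>
    proof -
      have "\<phi> (0 :: linf) = 0" using linf_charactersD(5)[OF that, of 0 0] by simp
      then show ?thesis using gelfand_inv[OF F that] \<open>g = 0\<close> by (simp add: g_def \<iota>_simps)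
    qed
    moreover have "F (Inr x) = 0" if "x \<in> topspace (torus I)" for x
      using zero(2)[OF _ _ that, of pi] by (simp add: H_def \<iota>_simps)
    ultimately have "F z = 0" for z using F by (cases "z \<in> topspace Z") (auto simp: topspace_Z cont_funs_def)
    then show ?thesis by auto
  qed
  have "isometric_shift (cont_funs S.X) (sup_norm S.X) S.T"
    by (rule S.isometric_shift_T) (rule orbit)
  then show ?thesis unfolding admits_isometric_shift_def S.X_def X_def by blast
qed

end

section \<open>The real and the complex case\<close>

lemma scalar_embedding_complex: "scalar_embedding (\<lambda>a. a :: complex) (\<lambda>a. a)"
  by unfold_locales (auto simp: continuous_on_id)

lemma scalar_embedding_real: "scalar_embedding complex_of_real Re"
proof
  show "linf_integral g \<in> range complex_of_real" if "AE z in circle_measure. rep_linf g z \<in> range complex_of_real" for g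
    using linf_integral_real that unfolding Reals_def .
  show "closed (range complex_of_real)" using closed_complex_Reals unfolding Reals_def .
qed (auto intro!: continuous_intros)

theorem theorem3p3:
  fixes I :: "'i set" and N :: "'n set"
    and X :: "(((linf \<Rightarrow> complex) + ('i \<Rightarrow> complex)) + 'n option) topology"
  assumes "I \<noteq> {}" and "I \<lesssim> (UNIV :: real set)"
    and "countable N" and "infinite N"
  defines "X \<equiv> disjoint_sum (disjoint_sum linf_max_ideal_space (torus I))
                  (Alexandroff_compactification (discrete_topology N))"
  shows "admits_isometric_shift (cont_funs X :: (_ \<Rightarrow> real) set) (sup_norm X)
       \<and> admits_isometric_shift (cont_funs X :: (_ \<Rightarrow> complex) set) (sup_norm X)"
proof -
  obtain j :: "'i \<Rightarrow> real" where j: "inj_on j I" using assms(2) by (auto simp: lepoll_def)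
  \<comment> \<open>The exponential makes all indices positive and so keeps 0 free for the angle on
    the maximal ideal space.\<close>
  have idx: "inj_on (\<lambda>i. exp (j i)) I" using j by (auto simp: inj_on_def)
  interpret R: rotated_sum complex_of_real Re I "\<lambda>i. exp (j i)"
    by (intro rotated_sum.intro scalar_embedding_real rotated_sum_axioms.intro idx) simp
  interpret C: rotated_sum "\<lambda>a. a" "\<lambda>a. a" I "\<lambda>i. exp (j i)"
    by (intro rotated_sum.intro scalar_embedding_complex rotated_sum_axioms.intro idx) simp
  show ?thesis
    using R.admits_isometric_shift_sum[OF assms(3,4)] C.admits_isometric_shift_sum[OF assms(3,4)]
    unfolding X_def R.Z_def C.Z_def by blast
qed

end
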